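(* (i) For every polynomial time computable function $f:\{0,1\}^*\to\{0,1\}^*$ there are a term $M_f$ and an integer $n_f$ such that $\vdash M_f:\mathbb{B}^{n_f}\multimap\mathbb{B}^0$ is derivable in $\mathsf{RH}(\emptyset)$ and $M_f$ represents $f$. (ii) For every elementary time computable function $f:\{0,1\}^*\to\{0,1\}^*$ there are a term $M_f$ and an integer $n_f$ such that $\vdash M_f:\mathbb{B}^{n_f}\multimap\mathbb{B}^0$ is derivable in $\mathsf{RH}(\mathsf{A})$ and $M_f$ represents $f$. Here "$M_f$ represents $f$" means $M_f\,\ulcorner s\urcorner\leadsto^*\ulcorner f(s)\urcorner$ for every $s\in\{0,1\}^*$.
   Context: Free algebras: a free algebra $\mathbb{A}=(\mathcal{C}_\mathbb{A},\mathcal{R}_\mathbb{A})$: finite constructor set $\{c^\mathbb{A}_1,\dots,c^\mathbb{A}_{k(\mathbb{A})}\}$ with arities. $\mathscr{A}$ is a fixed finite family of free algebras with pairwise disjoint constructor sets containing: $\mathbb{U}$ ($c_1^\mathbb{U}$ unary, $c_2^\mathbb{U}$ nullary), $\mathbb{B}$ ($c_1^\mathbb{B},c_2^\mathbb{B}$ unary, $c_3^\mathbb{B}$ nullary), $\mathbb{C}$ ($c_1^\mathbb{C}$ binary, $c_2^\mathbb{C}$ nullary), $\mathbb{D}$ ($c_1^\mathbb{D},c_2^\mathbb{D}$ binary, $c_3^\mathbb{D}$ nullary). Binary strings are encoded as $\ulcorner\varepsilon\urcorner=c_3^\mathbb{B}$, $\ulcorner 0s\urcorner=c_1^\mathbb{B}\ulcorner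 s\urcorner$, $\ulcorner 1s\urcorner=c_2^\mathbb{B}\ulcorner s\urcorner$. Terms: $M::=x\mid c\mid MM\mid \lambda x.M\mid M\{\!\{M,\dots,M\}\!\}\mid M\langle\!\langle M,\dots,M\rangle\!\rangle$. Types: $A::=\mathbb{A}^n\mid A\multimap A$. $A\multimap^0B=B$, $A\multimap^{n+1}B=A\multimap(A\multimap^nB)$; level $V(\mathbb{A}^n)=n$, $V(A\multimap B)=\max\{V(A),V(B)\}$. Typing rules: (A) $x:A\vdash x:A$; (W) from $\Gamma\vdash M:B$ infer $\Gamma,x:A\vdash M:B$; (C) from $\Gamma,x:A,y:A\vdash M:B$ infer $\Gamma,z:A\vdash M\{z/x,z/y\}:B$; ($I_\multimap$) from $\Gamma,x:A\vdash M:B$ infer $\Gamma\vdash\lambda x.M:A\multimap B$; ($E_\multimap$) from $\Gamma\vdash M:A\multimap B$, $\Delta\vdash N:A$ infer $\Gamma,\Delta\vdash MN:B$; ($I_\mathbb{A}$) $\vdash c:\mathbb{A}^n\multimap^{\mathcal{R}(c)}\mathbb{A}^n$; ($E^C_\mathbb{A}$) from $\Gamma_i\vdash M_{c^\mathbb{A}_i}:\mathbb{A}^m\multimap^{\mathcal{R}(c^\mathbb{A}_i)}C$ and $\Delta\vdash L:\mathbb{A}^m$ infer $\Gamma_1,\dots,\Gamma_{k(\mathbb{A})},\Delta\vdash L\{\!\{M_{c_1^\mathbb{A}},\dots\}\!\}:C$; ($E^R_\mathbb{A}$) from $\Gamma_i\vdash M_{c^\mathbb{A}_i}:\mathbb{A}^m\multimap^{\mathcal{R}(c^\mathbb{A}_i)}(C\multimap^{\mathcal{R}(c^\mathbb{A}_i)}C)$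 and $\Delta\vdash L:\mathbb{A}^m$ infer $\Gamma_1,\dots,\Gamma_{k(\mathbb{A})},\Delta\vdash L\langle\!\langle M_{c_1^\mathbb{A}},\dots\rangle\!\rangle:C$. For a class of types $\mathsf{D}$, $\mathsf{RH}(\mathsf{D})$ uses these rules, allowing rule (C) only when the contracted type is in $\mathsf{D}$, requiring all types in each $\Gamma_i$ of $E^R_\mathbb{A}$ to be in $\mathsf{D}$, and adding to $E^R_\mathbb{A}$ the premise $m>V(C)$. $\mathsf{A}=\{\mathbb{A}^n:\mathbb{A}\in\mathscr{A},n\in\mathbb{N}\}$; thus $\mathsf{RH}(\emptyset)$ forbids (C) altogether and requires empty $\Gamma_i$ in $E^R$. Values $V::=x\mid\lambda x.M\mid T$, $T::=c\mid TT$. Reduction $\to$: $(\lambda x.M)V\to M\{V/x\}$; $c_i^\mathbb{A}t_1\cdots t_r\{\!\{M_{c_1},\dots,M_{c_k}\}\!\}\to M_{c_i}t_1\cdots t_r$; $c_i^\mathbb{A}t_1\cdots t_r\langle\!\langle\vec M\rangle\!\rangle\to M_{c_i}t_1\cdots t_r(t_1\langle\!\langle\vec M\rangle\!\rangle)\cdots(t_r\langle\!\langle\vec M\rangle\!\rangle)$ with $r=\mathcal{R}(c_i^\mathbb{A})$, $t_j$ constructor terms. $\leadsto$ is the closure of $\to$ under application contexts on both sides and under the scrutinee position of conditionals/recursions (not under $\lambda$, not inside branches); $\leadsto^*$ its reflexive-transitive closure. Elementary time computable: computable by a Turing machine in time bounded by an elementary function (a tower of exponentials $2^{2^{\cdot^{\cdot^{2^n}}}}$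 of fixed height). *)

theory Defs
  imports "HOL-Computational_Algebra.Polynomial"
begin

text \<open>
  The algebras of the family are indexed by the type \<open>'a\<close>; \<open>'c\<close> is the type of all constructors
  of all algebras. \<open>constrs F a\<close> lists the constructors of the algebra \<open>a\<close>, so that its \<open>i\<close>-th
  constructor, counted from 1 on paper, is \<open>constrs F a ! (i - 1)\<close>.
\<close>

record ('a, 'c) algebra_family =
  constrs :: "'a \<Rightarrow> 'c list"
  arity :: "'c \<Rightarrow> nat"
  algU :: 'a
  algB :: 'a
  algC :: 'a
  algD :: 'a

definition free_algebra_family :: "('a::finite, 'c) algebra_family \<Rightarrow> bool" where
  "free_algebra_family F \<longleftrightarrow>
     (\<forall>a. distinct (constrs F a)) \<and>
     (\<forall>a b. a \<noteq> b \<longrightarrow> set (constrs F a) \<inter> set (constrs F b) = {}) \<and>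
     (\<Union>a. set (constrs F a)) = UNIV \<and>
     map (arity F) (constrs F (algU F)) = [1, 0] \<and>
     map (arity F) (constrs F (algB F)) = [1, 1, 0] \<and>
     map (arity F) (constrs F (algC F)) = [2, 0] \<and>
     map (arity F) (constrs F (algD F)) = [2, 2, 0]"

text \<open>
  Terms up to renaming of bound variables, in de Bruijn notation. \<open>Cond L Ms\<close> and \<open>Rec L Ms\<close> are
  the conditional and the recursion with scrutinee \<open>L\<close> and branches \<open>Ms\<close>.
\<close>

datatype 'c trm =
    Var nat
  | Con 'c
  | App "'c trm" "'c trm"
  | Lam "'c trm"
  | Cond "'c trm" "'c trm list"
  | Rec "'c trm" "'c trm list"

definition apps :: "'c trm \<Rightarrow> 'c trm list \<Rightarrow> 'c trm" where
  "apps M Ns = foldl App M Ns"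

primrec rename :: "(nat \<Rightarrow> nat) \<Rightarrow> 'c trm \<Rightarrow> 'c trm" where
  "rename \<rho> (Var x) = Var (\<rho> x)"
| "rename \<rho> (Con c) = Con c"
| "rename \<rho> (App M N) = App (rename \<rho> M) (rename \<rho> N)"
| "rename \<rho> (Lam M) = Lam (rename (case_nat 0 (\<lambda>x. Suc (\<rho> x))) M)"
| "rename \<rho> (Cond L Ms) = Cond (rename \<rho> L) (map (rename \<rho>) Ms)"
| "rename \<rho> (Rec L Ms) = Rec (rename \<rho> L) (map (rename \<rho>) Ms)"

primrec subst :: "(nat \<Rightarrow> 'c trm) \<Rightarrow> 'c trm \<Rightarrow> 'c trm" where
  "subst \<sigma> (Var x) = \<sigma> x"
| "subst \<sigma> (Con c) = Con c"
| "subst \<sigma> (App M N) = App (subst \<sigma> M) (subst \<sigma> N)"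
| "subst \<sigma> (Lam M) = Lam (subst (case_nat (Var 0) (\<lambda>x. rename Suc (\<sigma> x))) M)"
| "subst \<sigma> (Cond L Ms) = Cond (subst \<sigma> L) (map (subst \<sigma>) Ms)"
| "subst \<sigma> (Rec L Ms) = Rec (subst \<sigma> L) (map (subst \<sigma>) Ms)"

datatype 'a ty =
    Base 'a nat
  | Fun "'a ty" "'a ty"  (infixr \<open>\<multimap>\<close> 60)

primrec funpow_ty :: "nat \<Rightarrow> 'a ty \<Rightarrow> 'a ty \<Rightarrow> 'a ty" where
  "funpow_ty 0 A B = B"
| "funpow_ty (Suc n) A B = A \<multimap> funpow_ty n A B"

primrec level :: "'a ty \<Rightarrow> nat" where
  "level (Base a n) = n"
| "level (A \<multimap> B) = max (level A) (level B)"

definition base_types :: "'a ty set" where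
  "base_types = {Base a n | a n. True}"

text \<open>
  A context maps the free variables (their indices act as names) to their types. A juxtaposition of
  contexts is the union of maps with pairwise disjoint domains.
\<close>

type_synonym 'a ctx = "nat \<rightharpoonup> 'a ty"

definition disjoint_ctxs :: "'a ctx list \<Rightarrow> bool" where
  "disjoint_ctxs \<Gamma>s \<longleftrightarrow>
     (\<forall>i j. i < j \<longrightarrow> j < length \<Gamma>s \<longrightarrow> dom (\<Gamma>s ! i) \<inter> dom (\<Gamma>s ! j) = {})"

definition join_ctxs :: "'a ctx list \<Rightarrow> 'a ctx" where
  "join_ctxs \<Gamma>s = foldr (++) \<Gamma>s Map.empty"

text \<open>
  In rule \<open>abs\<close> the bound variable is index 0 and the remaining indices are shifted by one, which
  is the effect of \<open>case_nat\<close> on contexts.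
\<close>

inductive RH :: "('a, 'c) algebra_family \<Rightarrow> 'a ty set \<Rightarrow> 'a ctx \<Rightarrow> 'c trm \<Rightarrow> 'a ty \<Rightarrow> bool"
  for F :: "('a, 'c) algebra_family" and D :: "'a ty set"
where
  ax: "RH F D [x \<mapsto> A] (Var x) A"
| weak: "RH F D \<Gamma> M B \<Longrightarrow> x \<notin> dom \<Gamma> \<Longrightarrow> RH F D (\<Gamma>(x \<mapsto> A)) M B"
| contr: "RH F D (\<Gamma>(x \<mapsto> A, y \<mapsto> A)) M B \<Longrightarrow> x \<noteq> y \<Longrightarrow> x \<notin> dom \<Gamma> \<Longrightarrow> y \<notin> dom \<Gamma> \<Longrightarrow> z \<notin> dom \<Gamma>
    \<Longrightarrow> A \<in> D \<Longrightarrow> RH F D (\<Gamma>(z \<mapsto> A)) (rename (\<lambda>v. if v = x \<or> v = y then z else v) M) B"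
| abs: "RH F D (case_nat (Some A) \<Gamma>) M B \<Longrightarrow> RH F D \<Gamma> (Lam M) (A \<multimap> B)"
| app: "RH F D \<Gamma> M (A \<multimap> B) \<Longrightarrow> RH F D \<Delta> N A \<Longrightarrow> disjoint_ctxs [\<Gamma>, \<Delta>]
    \<Longrightarrow> RH F D (join_ctxs [\<Gamma>, \<Delta>]) (App M N) B"
| con: "c \<in> set (constrs F a)
    \<Longrightarrow> RH F D Map.empty (Con c) (funpow_ty (arity F c) (Base a n) (Base a n))"
| cond: "length Ms = length (constrs F a) \<Longrightarrow> length \<Gamma>s = length Ms
    \<Longrightarrow> (\<And>i. i < length Ms \<Longrightarrow>
          RH F D (\<Gamma>s ! i) (Ms ! i) (funpow_ty (arity F (constrs F a ! i)) (Base a m) C))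
    \<Longrightarrow> RH F D \<Delta> L (Base a m) \<Longrightarrow> disjoint_ctxs (\<Gamma>s @ [\<Delta>])
    \<Longrightarrow> RH F D (join_ctxs (\<Gamma>s @ [\<Delta>])) (Cond L Ms) C"
| recur: "length Ms = length (constrs F a) \<Longrightarrow> length \<Gamma>s = length Ms
    \<Longrightarrow> (\<And>i. i < length Ms \<Longrightarrow>
          RH F D (\<Gamma>s ! i) (Ms ! i)
            (funpow_ty (arity F (constrs F a ! i)) (Base a m)
              (funpow_ty (arity F (constrs F a ! i)) C C)))
    \<Longrightarrow> RH F D \<Delta> L (Base a m) \<Longrightarrow> disjoint_ctxs (\<Gamma>s @ [\<Delta>])
    \<Longrightarrow> (\<And>i. i < length Ms \<Longrightarrow> ran (\<Gamma>s ! i) \<subseteq> D)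
    \<Longrightarrow> level C < m
    \<Longrightarrow> RH F D (join_ctxs (\<Gamma>s @ [\<Delta>])) (Rec L Ms) C"

inductive constructor_term :: "'c trm \<Rightarrow> bool" where
  "constructor_term (Con c)"
| "constructor_term M \<Longrightarrow> constructor_term N \<Longrightarrow> constructor_term (App M N)"

inductive val :: "'c trm \<Rightarrow> bool" where
  "val (Var x)"
| "val (Lam M)"
| "constructor_term M \<Longrightarrow> val M"

inductive contracts :: "('a, 'c) algebra_family \<Rightarrow> 'c trm \<Rightarrow> 'c trm \<Rightarrow> bool"
  for F :: "('a, 'c) algebra_family"
where
  beta: "val V \<Longrightarrow> contracts F (App (Lam M) V) (subst (case_nat V Var) M)"
| cond: "i < length (constrs F a) \<Longrightarrow> length Ms = length (constrs F a)
    \<Longrightarrow> length ts = arity F (constrs F a ! i) \<Longrightarrow> (\<forall>t \<in> set ts. constructor_term t)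
    \<Longrightarrow> contracts F (Cond (apps (Con (constrs F a ! i)) ts) Ms) (apps (Ms ! i) ts)"
| recur: "i < length (constrs F a) \<Longrightarrow> length Ms = length (constrs F a)
    \<Longrightarrow> length ts = arity F (constrs F a ! i) \<Longrightarrow> (\<forall>t \<in> set ts. constructor_term t)
    \<Longrightarrow> contracts F (Rec (apps (Con (constrs F a ! i)) ts) Ms)
          (apps (Ms ! i) (ts @ map (\<lambda>t. Rec t Ms) ts))"

inductive reduces :: "('a, 'c) algebra_family \<Rightarrow> 'c trm \<Rightarrow> 'c trm \<Rightarrow> bool"
  for F :: "('a, 'c) algebra_family"
where
  contract: "contracts F M N \<Longrightarrow> reduces F M N"
| appL: "reduces F M N \<Longrightarrow> reduces F (App M L) (App N L)"
| appR: "reduces F M N \<Longrightarrow> reduces F (App L M) (App L N)"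
| cond: "reduces F M N \<Longrightarrow> reduces F (Cond M Ls) (Cond N Ls)"
| recur: "reduces F M N \<Longrightarrow> reduces F (Rec M Ls) (Rec N Ls)"

text \<open>The letters 0 and 1 are \<open>False\<close> and \<open>True\<close>.\<close>

primrec encode :: "('a, 'c) algebra_family \<Rightarrow> bool list \<Rightarrow> 'c trm" where
  "encode F [] = Con (constrs F (algB F) ! 2)"
| "encode F (b # s) = App (Con (constrs F (algB F) ! (if b then 1 else 0))) (encode F s)"

definition represents ::
  "('a, 'c) algebra_family \<Rightarrow> 'c trm \<Rightarrow> (bool list \<Rightarrow> bool list) \<Rightarrow> bool" where
  "represents F M f \<longleftrightarrow> (\<forall>s. (reduces F)\<^sup>*\<^sup>* (App M (encode F s)) (encode F (f s)))"

text \<open>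
  Deterministic machines with one tape, infinite in both directions. States are
  \<open>{0..<nstates}\<close> with initial state 0, tape symbols are \<open>{0..<nsymbols}\<close>, where 0 is the blank
  and 1, 2 stand for the letters 0, 1. The machine halts where \<open>delta\<close> is \<open>None\<close>.
\<close>

datatype move = MLeft | MRight | MStay

record tm =
  nstates :: nat
  nsymbols :: nat
  delta :: "nat \<Rightarrow> nat \<Rightarrow> (nat \<times> nat \<times> move) option"

definition wf_tm :: "tm \<Rightarrow> bool" where
  "wf_tm T \<longleftrightarrow> 0 < nstates T \<and> 3 \<le> nsymbols T \<and>
     (\<forall>q a q' b d. q < nstates T \<longrightarrow> a < nsymbols T \<longrightarrow> delta T q a = Some (q', b, d) \<longrightarrow>
        q' < nstates T \<and> b < nsymbols T)"

text \<open>A configuration consists of the state, the tape and the position of the head.\<close>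

type_synonym tm_config = "nat \<times> (int \<Rightarrow> nat) \<times> int"

fun move_head :: "move \<Rightarrow> int \<Rightarrow> int" where
  "move_head MLeft h = h - 1"
| "move_head MRight h = h + 1"
| "move_head MStay h = h"

fun tm_halted :: "tm \<Rightarrow> tm_config \<Rightarrow> bool" where
  "tm_halted T (q, tp, h) \<longleftrightarrow> delta T q (tp h) = None"

fun tm_step :: "tm \<Rightarrow> tm_config \<Rightarrow> tm_config" where
  "tm_step T (q, tp, h) =
     (case delta T q (tp h) of
        None \<Rightarrow> (q, tp, h)
      | Some (q', b, d) \<Rightarrow> (q', tp(h := b), move_head d h))"

definition letter :: "bool \<Rightarrow> nat" where
  "letter b = (if b then 2 else 1)"

definition tm_init :: "bool list \<Rightarrow> tm_config" where
  "tm_init s = (0, (\<lambda>i. if 0 \<le> i \<and> i < int (length s) then letter (s ! nat i) else 0), 0)"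

text \<open>The output is the string from the head position up to the first blank.\<close>

fun tm_output :: "tm_config \<Rightarrow> bool list \<Rightarrow> bool" where
  "tm_output (q, tp, h) w \<longleftrightarrow>
     (\<forall>i < length w. tp (h + int i) = letter (w ! i)) \<and> tp (h + int (length w)) = 0"

definition computes_in_time :: "tm \<Rightarrow> (bool list \<Rightarrow> bool list) \<Rightarrow> (nat \<Rightarrow> nat) \<Rightarrow> bool" where
  "computes_in_time T f b \<longleftrightarrow>
     (\<forall>s. \<exists>t \<le> b (length s). tm_halted T ((tm_step T ^^ t) (tm_init s)) \<and>
            tm_output ((tm_step T ^^ t) (tm_init s)) (f s))"

definition polytime_computable :: "(bool list \<Rightarrow> bool list) \<Rightarrow> bool" where
  "polytime_computable f \<longleftrightarrow> (\<exists>T (p :: nat poly). wf_tm T \<and> computes_in_time T f (poly p))"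

primrec tower :: "nat \<Rightarrow> nat \<Rightarrow> nat" where
  "tower 0 n = n"
| "tower (Suc k) n = 2 ^ tower k n"

definition elementary_time_computable :: "(bool list \<Rightarrow> bool list) \<Rightarrow> bool" where
  "elementary_time_computable f \<longleftrightarrow> (\<exists>T k. wf_tm T \<and> computes_in_time T f (tower k))"

end

theory Submission
  imports Defs
begin

text \<open>
  A configuration of a Turing machine is a binary tree over the algebra \<open>C\<close>, and one step is a
  closed term of type \<open>C\<^sup>1 \<multimap> C\<^sup>1\<close> that inspects the tree by nested conditionals. All branches of
  conditionals and recursions are closed, and the pieces of the tree reach them as arguments, so
  that the disjointness of contexts is never an obstacle. It remains to iterate the step often
  enough. Without contraction, recursion on a numeral \<open>n\<close> still passes the predecessor along with
  the result on it, and nesting this \<open>k\<close> times gives \<open>n choose k\<close> iterations, which bounds any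
  polynomial after shifting \<open>n\<close> by a constant. With contraction at base types, iterating
  \<open>t \<mapsto> node t t\<close> once per leaf of a tree yields a full tree with exponentially many leaves, at the
  cost of one level; \<open>k\<close> such rounds followed by iterating the step once per leaf give a tower of
  height \<open>k\<close>.
\<close>

section \<open>Closed terms\<close>

text \<open>Invariance under every substitution serves directly as a rewrite rule: in a beta step
  the closed pieces of a program and the values already passed to it stay put.\<close>

definition closed_trm :: "'c trm \<Rightarrow> bool" where
  "closed_trm M \<longleftrightarrow> (\<forall>\<sigma>. subst \<sigma> M = M)"

lemma rename_eq_subst: "rename \<rho> M = subst (\<lambda>x. Var (\<rho> x)) M"
proof (induction M arbitrary: \<rho>)
  case (Lam M)
  have "subst (\<lambda>x. Var (case_nat 0 (\<lambda>x. Suc (\<rho> x)) x)) M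
      = subst (case_nat (Var 0) (\<lambda>x. rename Suc (Var (\<rho> x)))) M"
    by (rule arg_cong[of _ _ "\<lambda>\<sigma>. subst \<sigma> M"]) (auto split: nat.split)
  then show ?case by (simp add: Lam)
qed auto

lemma closedI: "(\<And>\<sigma>. subst \<sigma> M = M) \<Longrightarrow> closed_trm M"
  by (simp add: closed_trm_def)

lemma closed_subst [simp]: "closed_trm M \<Longrightarrow> subst \<sigma> M = M"
  by (simp add: closed_trm_def)

lemma closed_rename [simp]: "closed_trm M \<Longrightarrow> rename \<rho> M = M"
  by (simp add: rename_eq_subst)

declare constructor_term.intros [simp]

lemma val_simps [simp]: "val (Lam M)" "constructor_term M \<Longrightarrow> val M"
  by (simp_all add: val.intros)

lemma constructor_term_closed [simp]: "constructor_term M \<Longrightarrow> closed_trm M"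
  by (induction rule: constructor_term.induct) (auto intro: closedI)

lemma apps_simps [simp]: "apps M [] = M" "apps M (N # Ns) = apps (App M N) Ns"
  by (simp_all add: apps_def)

subsection \<open>Typing with explicit sets of used variables\<close>

text \<open>Rule \<open>weak\<close> adds one variable at a time, so the induction is over the
  finite set \<open>X\<close> of variables already added to \<open>dom \<Gamma>\<close>.\<close>

lemma RH_weaken:
  assumes "RH F D \<Gamma> M B" "\<Gamma> \<subseteq>\<^sub>m \<Gamma>'" "finite (dom \<Gamma>')"
  shows "RH F D \<Gamma>' M B"
proof -
  have "RH F D (\<Gamma>' |` (dom \<Gamma> \<union> X)) M B" if "finite X" "X \<subseteq> dom \<Gamma>' - dom \<Gamma>" for X
    using that
  proof (induction X rule: finite_induct)
    case empty
    have "\<Gamma>' |` dom \<Gamma> = \<Gamma>"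
      using assms(2) by (auto simp: map_le_def restrict_map_def fun_eq_iff domIff)
    then show ?case using assms(1) by simp
  next
    case (insert x X)
    then obtain A where A: "\<Gamma>' x = Some A" by auto
    have "\<Gamma>' |` (dom \<Gamma> \<union> insert x X) = (\<Gamma>' |` (dom \<Gamma> \<union> X))(x \<mapsto> A)"
      using A by (auto simp: restrict_map_def fun_eq_iff)
    moreover have "RH F D ((\<Gamma>' |` (dom \<Gamma> \<union> X))(x \<mapsto> A)) M B"
      using insert by (intro RH.weak) auto
    ultimately show ?case by (simp only:)
  qed
  from this[of "dom \<Gamma>' - dom \<Gamma>"] assms
  have "RH F D (\<Gamma>' |` (dom \<Gamma> \<union> (dom \<Gamma>' - dom \<Gamma>))) M B" by auto
  moreover have "\<Gamma>' |` (dom \<Gamma> \<union> (dom \<Gamma>' - dom \<Gamma>)) = \<Gamma>'"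
    by (auto simp: restrict_map_def fun_eq_iff domIff)
  ultimately show ?thesis by simp
qed

text \<open>With the scope \<open>E\<close> fixed for all subterms, dividing a context between
  function and argument amounts to dividing the index set \<open>U\<close>.\<close>

definition ctx_of :: "'a ty list \<Rightarrow> nat set \<Rightarrow> 'a ctx" where
  "ctx_of E U i = (if i \<in> U \<and> i < length E then Some (E ! i) else None)"

lemma finite_dom_ctx_of [simp]: "finite (dom (ctx_of E U))"
  by (rule finite_subset[of _ "{..<length E}"]) (auto simp: ctx_of_def split: if_splits)

text \<open>
  In \<open>uses F D E U M A\<close> the list \<open>E\<close> types all the variables in scope and \<open>U\<close> collects
  the ones that are consumed.
\<close>

definition uses ::
  "('a, 'c) algebra_family \<Rightarrow> 'a ty set \<Rightarrow> 'a ty list \<Rightarrow> nat set \<Rightarrow> 'c trm \<Rightarrow> 'a ty \<Rightarrow> bool" where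
  "uses F D E U M A \<longleftrightarrow> RH F D (ctx_of E U) M A"

lemma uses_Nil: "uses F D [] U M A \<Longrightarrow> RH F D Map.empty M A"
proof -
  have "ctx_of [] U = Map.empty" by (auto simp: ctx_of_def)
  from arg_cong[OF this, of "\<lambda>\<Gamma>. RH F D \<Gamma> M A"]
  show "uses F D [] U M A \<Longrightarrow> ?thesis" by (simp only: uses_def)
qed

lemma uses_closed: "RH F D Map.empty M A \<Longrightarrow> uses F D E {} M A"
  unfolding uses_def by (rule RH_weaken) auto

lemma uses_Var: "i < length E \<Longrightarrow> E ! i = A \<Longrightarrow> uses F D E {i} (Var i) A"
  unfolding uses_def by (rule RH_weaken[OF RH.ax]) (auto simp: ctx_of_def map_le_def)

lemma uses_App:
  assumes "uses F D E U M (A \<multimap> B)" "uses F D E V N A" "U \<inter> V = {}"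
  shows "uses F D E (U \<union> V) (App M N) B"
proof -
  have "RH F D (join_ctxs [ctx_of E U, ctx_of E V]) (App M N) B"
    using assms unfolding uses_def
    by (intro RH.app) (auto simp: disjoint_ctxs_def ctx_of_def less_Suc_eq split: if_splits)
  moreover have "join_ctxs [ctx_of E U, ctx_of E V] = ctx_of E (U \<union> V)"
    using assms(3) by (auto simp: join_ctxs_def ctx_of_def map_add_def fun_eq_iff)
  ultimately show ?thesis by (simp add: uses_def)
qed

lemma uses_Lam:
  assumes "uses F D (A # E) U M B" "V = {i. Suc i \<in> U}"
  shows "uses F D E V (Lam M) (A \<multimap> B)"
proof -
  \<comment> \<open>Index 0 is added by weakening, so an abstraction that discards its argument is
    covered as well.\<close>
  have "RH F D (ctx_of (A # E) (insert 0 U)) M B"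
    using assms(1) unfolding uses_def by (rule RH_weaken) (auto simp: ctx_of_def map_le_def)
  moreover have "ctx_of (A # E) (insert 0 U) = case_nat (Some A) (ctx_of E V)"
    using assms(2) by (auto simp: ctx_of_def split: nat.split)
  ultimately show ?thesis by (simp add: uses_def RH.abs)
qed

lemma join_ctxs_replicate_empty [simp]:
  "join_ctxs (replicate n Map.empty @ [\<Delta>]) = \<Delta>"
  by (induction n) (auto simp: join_ctxs_def)

lemma disjoint_ctxs_replicate_empty [simp]:
  "disjoint_ctxs (replicate n Map.empty @ [\<Delta>])"
  by (auto simp: disjoint_ctxs_def nth_append)

lemma uses_Cond:
  assumes "length Ms = length (constrs F a)"
    and "\<And>i. i < length Ms \<Longrightarrow>
      RH F D Map.empty (Ms ! i) (funpow_ty (arity F (constrs F a ! i)) (Base a m) C)"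
    and "uses F D E U L (Base a m)"
  shows "uses F D E U (Cond L Ms) C"
  using RH.cond[of Ms F a "replicate (length Ms) Map.empty" D m C "ctx_of E U" L] assms
  by (simp add: uses_def)

text \<open>Empty branch contexts meet the condition
  \<open>ran (\<Gamma>s ! i) \<subseteq> D\<close> for every \<open>D\<close>, including the empty
  set, so the same recursions are typable in both systems.\<close>

lemma uses_Rec:
  assumes "length Ms = length (constrs F a)"
    and "\<And>i. i < length Ms \<Longrightarrow>
      RH F D Map.empty (Ms ! i) (funpow_ty (arity F (constrs F a ! i)) (Base a m)
        (funpow_ty (arity F (constrs F a ! i)) C C))"
    and "uses F D E U L (Base a m)" "level C < m"
  shows "uses F D E U (Rec L Ms) C"
  using RH.recur[of Ms F a "replicate (length Ms) Map.empty" D m C "ctx_of E U" L] assms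
  by (simp add: uses_def)

subsection \<open>Reduction\<close>

context
  fixes F :: "('a, 'c) algebra_family"
begin

abbreviation reds :: "'c trm \<Rightarrow> 'c trm \<Rightarrow> bool" (infix \<open>\<leadsto>*\<close> 50) where
  "M \<leadsto>* N \<equiv> (reduces F)\<^sup>*\<^sup>* M N"

lemma reds_App:
  assumes "M \<leadsto>* M'" "N \<leadsto>* N'"
  shows "App M N \<leadsto>* App M' N'"
proof -
  have "App M N \<leadsto>* App M' N"
    using assms(1) by induction (auto intro: rtranclp.rtrancl_into_rtrancl reduces.appL)
  also have "App M' N \<leadsto>* App M' N'"
    using assms(2) by induction (auto intro: rtranclp.rtrancl_into_rtrancl reduces.appR)
  finally show ?thesis .
qed

lemma reds_beta_eq: "val V \<Longrightarrow> subst (case_nat V Var) M = N \<Longrightarrow> App (Lam M) V \<leadsto>* N"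
  by (drule sym, simp only:, intro r_into_rtranclp reduces.contract contracts.beta)

text \<open>Together with \<open>reds_beta_eq\<close> this evaluates a curried function on several
  values; with the substitution given by an equation, its result is computed by
  simplification.\<close>

lemma reds_App_beta:
  assumes "val V" "M \<leadsto>* Lam N" "subst (case_nat V Var) N = L"
  shows "App M V \<leadsto>* L"
  using reds_App[OF assms(2) rtranclp.rtrancl_refl] reds_beta_eq[OF assms(1,3)]
  by (meson rtranclp_trans)

end

subsection \<open>Binary trees as data\<close>

datatype btree = Leaf | Node btree btree

primrec left_depth :: "btree \<Rightarrow> nat" where
  "left_depth Leaf = 0"
| "left_depth (Node s t) = Suc (left_depth s)"

primrec leaves :: "btree \<Rightarrow> nat" where
  "leaves Leaf = 1"
| "leaves (Node s t) = leaves s + leaves t"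

primrec full :: "nat \<Rightarrow> btree" where
  "full 0 = Leaf"
| "full (Suc n) = Node (full n) (full n)"

text \<open>Numerals are left combs. They code states and symbols and, having one leaf more than
  their value, also drive the clocks that count leaves.\<close>

primrec num :: "nat \<Rightarrow> btree" where
  "num 0 = Leaf"
| "num (Suc n) = Node (num n) Leaf"

primrec stack :: "nat list \<Rightarrow> btree" where
  "stack [] = Leaf"
| "stack (a # r) = Node (num a) (stack r)"

lemma left_depth_num [simp]: "left_depth (num n) = n"
  by (induction n) auto

lemma leaves_num [simp]: "leaves (num n) = Suc n"
  by (induction n) auto

lemma leaves_full [simp]: "leaves (full n) = 2 ^ n"
  by (induction n) auto

locale free_algebras =
  fixes F :: "('a::finite, 'c) algebra_family"
  assumes family: "free_algebra_family F"
begin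

abbreviation reds_F :: "'c trm \<Rightarrow> 'c trm \<Rightarrow> bool" (infix \<open>\<leadsto>*\<close> 50) where
  "M \<leadsto>* N \<equiv> (reduces F)\<^sup>*\<^sup>* M N"

abbreviation typed :: "'a ty set \<Rightarrow> 'c trm \<Rightarrow> 'a ty \<Rightarrow> bool" where
  "typed D M A \<equiv> RH F D Map.empty M A"

abbreviation leaf :: "'c trm" where
  "leaf \<equiv> Con (constrs F (algC F) ! Suc 0)"

abbreviation node :: "'c trm \<Rightarrow> 'c trm \<Rightarrow> 'c trm" where
  "node M N \<equiv> App (App (Con (constrs F (algC F) ! 0)) M) N"

abbreviation tree :: "nat \<Rightarrow> 'a ty" where
  "tree n \<equiv> Base (algC F) n"

abbreviation str :: "nat \<Rightarrow> 'a ty" where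
  "str n \<equiv> Base (algB F) n"

primrec tree_trm :: "btree \<Rightarrow> 'c trm" where
  "tree_trm Leaf = leaf"
| "tree_trm (Node s t) = node (tree_trm s) (tree_trm t)"

lemma algC:
  "length (constrs F (algC F)) = Suc (Suc 0)"
  "arity F (constrs F (algC F) ! 0) = Suc (Suc 0)" "arity F (constrs F (algC F) ! Suc 0) = 0"
proof -
  have *: "map (arity F) (constrs F (algC F)) = [2, 0]"
    using family by (simp add: free_algebra_family_def)
  show l: "length (constrs F (algC F)) = Suc (Suc 0)"
    using arg_cong[OF *, of length] by simp
  show "arity F (constrs F (algC F) ! 0) = Suc (Suc 0)" "arity F (constrs F (algC F) ! Suc 0) = 0"
    using arg_cong[OF *, of "\<lambda>l. l ! 0"] arg_cong[OF *, of "\<lambda>l. l ! 1"] l by simp_all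
qed

lemma algB:
  "length (constrs F (algB F)) = Suc (Suc (Suc 0))"
  "arity F (constrs F (algB F) ! 0) = Suc 0" "arity F (constrs F (algB F) ! Suc 0) = Suc 0"
  "arity F (constrs F (algB F) ! Suc (Suc 0)) = 0"
proof -
  have *: "map (arity F) (constrs F (algB F)) = [1, 1, 0]"
    using family by (simp add: free_algebra_family_def)
  show l: "length (constrs F (algB F)) = Suc (Suc (Suc 0))"
    using arg_cong[OF *, of length] by simp
  show "arity F (constrs F (algB F) ! 0) = Suc 0" "arity F (constrs F (algB F) ! Suc 0) = Suc 0"
    "arity F (constrs F (algB F) ! Suc (Suc 0)) = 0"
    using arg_cong[OF *, of "\<lambda>l. l ! 0"] arg_cong[OF *, of "\<lambda>l. l ! 1"]
      arg_cong[OF *, of "\<lambda>l. l ! 2"] l by (simp_all add: numeral_2_eq_2)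
qed

lemma constructor_term_tree [simp]: "constructor_term (tree_trm t)"
  by (induction t) auto

lemma constructor_term_encode [simp]: "constructor_term (encode F s)"
  by (induction s) auto

lemma reds_trans [trans]: "M \<leadsto>* N \<Longrightarrow> N \<leadsto>* L \<Longrightarrow> M \<leadsto>* L"
  by (rule rtranclp_trans)

subsubsection \<open>Typing rules for trees and strings\<close>

lemma typed_leaf: "typed D leaf (tree n)"
  using RH.con[of "constrs F (algC F) ! 1" F "algC F" D n] algC by simp

lemma typed_node: "typed D (Con (constrs F (algC F) ! 0)) (tree n \<multimap> tree n \<multimap> tree n)"
  using RH.con[of "constrs F (algC F) ! 0" F "algC F" D n] algC
  by simp

lemma uses_node:
  assumes "uses F D E U M (tree n)" "uses F D E V N (tree n)" "U \<inter> V = {}"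
  shows "uses F D E (U \<union> V) (node M N) (tree n)"
  using uses_App[OF uses_App[OF uses_closed[OF typed_node] assms(1)] assms(2)] assms(3) by simp

lemma typed_node_App:
  "typed D M (tree n) \<Longrightarrow> typed D N (tree n) \<Longrightarrow> typed D (node M N) (tree n)"
  by (rule uses_Nil[OF uses_node[OF uses_closed uses_closed]]) simp_all

lemma typed_tree: "typed D (tree_trm t) (tree n)"
proof (induction t)
  case Leaf
  show ?case unfolding tree_trm.simps by (rule typed_leaf)
next
  case (Node s t)
  then show ?case unfolding tree_trm.simps by (rule typed_node_App)
qed

lemma typed_eps: "typed D (encode F []) (str n)"
  using RH.con[of "constrs F (algB F) ! 2" F "algB F" D n] algB by (simp add: numeral_2_eq_2)

lemma typed_letter:
  "typed D (Con (constrs F (algB F) ! (if b then 1 else 0))) (str n \<multimap> str n)"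
  using RH.con[of "constrs F (algB F) ! (if b then 1 else 0)" F "algB F" D n] algB by (cases b) auto

lemma uses_Cond_tree:
  assumes "typed D M (tree m \<multimap> tree m \<multimap> A)" "typed D N A" "uses F D E U L (tree m)"
  shows "uses F D E U (Cond L [M, N]) A"
  by (rule uses_Cond[OF _ _ assms(3)])
    (use assms(1,2) algC in \<open>auto simp: less_Suc_eq\<close>)

lemma uses_Rec_tree:
  assumes "typed D M (tree m \<multimap> tree m \<multimap> A \<multimap> A \<multimap> A)" "typed D N A"
    and "uses F D E U L (tree m)" "level A < m"
  shows "uses F D E U (Rec L [M, N]) A"
  by (rule uses_Rec[OF _ _ assms(3)])
    (use assms(1,2,4) algC in \<open>auto simp: less_Suc_eq\<close>)

lemma uses_Rec_str:
  assumes "typed D M (str m \<multimap> A \<multimap> A)" "typed D M' (str m \<multimap> A \<multimap> A)" "typed D N A"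
    and "uses F D E U L (str m)" "level A < m"
  shows "uses F D E U (Rec L [M, M', N]) A"
  by (rule uses_Rec[OF _ _ assms(4)])
    (use assms(1,2,3,5) algB in \<open>auto simp: less_Suc_eq\<close>)

subsubsection \<open>Reduction rules for trees and strings\<close>

lemma Cond_leaf: "Cond leaf [M, N] \<leadsto>* N"
  using contracts.cond[of 1 F "algC F" "[M, N]" "[]"] algC
  by (intro r_into_rtranclp reduces.contract) simp

lemma Cond_node:
  assumes "constructor_term S" "constructor_term T"
  shows "Cond (node S T) [M, N] \<leadsto>* App (App M S) T"
  using contracts.cond[of 0 F "algC F" "[M, N]" "[S, T]"] algC assms
  by (intro r_into_rtranclp reduces.contract) simp

lemma Rec_leaf: "Rec leaf [M, N] \<leadsto>* N"
  using contracts.recur[of 1 F "algC F" "[M, N]" "[]"] algC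
  by (intro r_into_rtranclp reduces.contract) simp

lemma Rec_node:
  assumes "constructor_term S" "constructor_term T"
    and "Rec S [M, N] \<leadsto>* S'" "Rec T [M, N] \<leadsto>* T'"
  shows "Rec (node S T) [M, N] \<leadsto>* App (App (App (App M S) T) S') T'"
proof -
  have "Rec (node S T) [M, N] \<leadsto>* App (App (App (App M S) T) (Rec S [M, N])) (Rec T [M, N])"
    using contracts.recur[of 0 F "algC F" "[M, N]" "[S, T]"] algC assms(1,2)
    by (intro r_into_rtranclp reduces.contract) simp
  also have "\<dots> \<leadsto>* App (App (App (App M S) T) S') T'"
    using assms(3,4) by (intro reds_App) auto
  finally show ?thesis .
qed

lemma Rec_eps: "Rec (encode F []) [M, M', N] \<leadsto>* N"
  using contracts.recur[of 2 F "algB F" "[M, M', N]" "[]"] algB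
  by (intro r_into_rtranclp reduces.contract) (simp add: numeral_2_eq_2)

lemma Rec_letter:
  assumes "Rec (encode F s) [M, M', N] \<leadsto>* L"
  shows "Rec (encode F (b # s)) [M, M', N] \<leadsto>* App (App (if b then M' else M) (encode F s)) L"
proof -
  let ?i = "if b then 1 else 0 :: nat"
  have "Rec (apps (Con (constrs F (algB F) ! ?i)) [encode F s]) [M, M', N]
      \<leadsto>* apps ([M, M', N] ! ?i) ([encode F s] @ map (\<lambda>t. Rec t [M, M', N]) [encode F s])"
    by (intro r_into_rtranclp reduces.contract contracts.recur) (use algB in simp_all)
  also have "apps (Con (constrs F (algB F) ! ?i)) [encode F s] = encode F (b # s)"
    by simp
  also have "apps ([M, M', N] ! ?i) ([encode F s] @ map (\<lambda>t. Rec t [M, M', N]) [encode F s])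
      = App (App (if b then M' else M) (encode F s)) (Rec (encode F s) [M, M', N])"
    by simp
  also have "\<dots> \<leadsto>* App (App (if b then M' else M) (encode F s)) L"
    by (intro reds_App assms rtranclp.rtrancl_refl)
  finally show ?thesis .
qed

section \<open>Case analysis on trees by closed terms\<close>

text \<open>The branches are meant to be closed. They may return functions, so that data not under
  inspection arrive as later arguments instead of being free in a branch.\<close>

definition unpair :: "'c trm \<Rightarrow> 'c trm \<Rightarrow> 'c trm" where
  "unpair M N = Lam (Cond (Var 0) [M, N])"

lemma closed_unpair [simp]: "closed_trm M \<Longrightarrow> closed_trm N \<Longrightarrow> closed_trm (unpair M N)"
  by (rule closedI) (simp add: unpair_def)

lemma typed_unpair:
  assumes "typed D M (tree m \<multimap> tree m \<multimap> A)" "typed D N A"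
  shows "typed D (unpair M N) (tree m \<multimap> A)"
  unfolding unpair_def
  by (rule uses_Nil, rule uses_Lam, rule uses_Cond_tree[OF assms], rule uses_Var) auto

lemma unpair_Leaf:
  assumes "closed_trm M" "closed_trm N"
  shows "App (unpair M N) (tree_trm Leaf) \<leadsto>* N"
proof -
  have "App (unpair M N) (tree_trm Leaf) \<leadsto>* Cond leaf [M, N]"
    unfolding unpair_def using assms by (intro reds_beta_eq) auto
  also have "\<dots> \<leadsto>* N" by (rule Cond_leaf)
  finally show ?thesis .
qed

lemma unpair_Node:
  assumes "closed_trm M" "closed_trm N"
  shows "App (unpair M N) (tree_trm (Node s t)) \<leadsto>* App (App M (tree_trm s)) (tree_trm t)"
proof -
  have "App (unpair M N) (tree_trm (Node s t)) \<leadsto>* Cond (tree_trm (Node s t)) [M, N]"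
    unfolding unpair_def using assms by (intro reds_beta_eq) auto
  also have "\<dots> \<leadsto>* App (App M (tree_trm s)) (tree_trm t)" using Cond_node by simp
  finally show ?thesis .
qed

text \<open>A case distinction on \<open>left_depth\<close>: each entry of the list costs one
  descent to the left child, and \<open>N\<close> is the default beyond the list.\<close>

primrec select :: "'c trm \<Rightarrow> 'c trm list \<Rightarrow> 'c trm" where
  "select N [] = Lam N"
| "select N (M # Ms) = unpair (Lam (Lam (App (select N Ms) (Var (Suc 0))))) M"

lemma closed_select [simp]:
  "closed_trm N \<Longrightarrow> \<forall>M \<in> set Ms. closed_trm M \<Longrightarrow> closed_trm (select N Ms)"
proof (induction Ms)
  case Nil
  then show ?case by (intro closedI) simp
next
  case (Cons M Ms)
  then have "closed_trm (select N Ms)" "closed_trm M" by auto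
  moreover from this have "closed_trm (Lam (Lam (App (select N Ms) (Var (Suc 0)))))"
    by (intro closedI) simp
  ultimately show ?case by simp
qed

lemma typed_select:
  assumes "typed D N A" "\<And>M. M \<in> set Ms \<Longrightarrow> typed D M A"
  shows "typed D (select N Ms) (tree m \<multimap> A)"
  using assms(2)
proof (induction Ms)
  case Nil
  show ?case
    by (simp, rule uses_Nil, rule uses_Lam, rule uses_closed[OF assms(1)]) simp
next
  case (Cons M Ms)
  then have *: "typed D (select N Ms) (tree m \<multimap> A)" "typed D M A" by auto
  have "typed D (Lam (Lam (App (select N Ms) (Var (Suc 0))))) (tree m \<multimap> tree m \<multimap> A)"
    by (rule uses_Nil) (rule uses_Lam uses_App uses_Var uses_closed[OF *(1)] refl | simp)+
  then show ?case using *(2) by (simp add: typed_unpair)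
qed

lemma select_reds:
  assumes "closed_trm N" "\<forall>M \<in> set Ms. closed_trm M"
  shows "App (select N Ms) (tree_trm t)
    \<leadsto>* (if left_depth t < length Ms then Ms ! left_depth t else N)"
  using assms(2)
proof (induction Ms arbitrary: t)
  case Nil
  have "App (Lam N) (tree_trm t) \<leadsto>* N"
    by (rule reds_beta_eq) (simp_all add: assms(1))
  then show ?case by simp
next
  case (Cons M Ms)
  let ?M = "Lam (Lam (App (select N Ms) (Var (Suc 0))))"
  have c: "closed_trm (select N Ms)" "closed_trm M" using assms(1) Cons.prems by auto
  have cM: "closed_trm ?M" by (rule closedI) (simp add: c)
  have less: "\<And>t. App (select N Ms) (tree_trm t)
      \<leadsto>* (if left_depth t < length Ms then Ms ! left_depth t else N)"
    by (rule Cons.IH) (use Cons.prems in simp)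
  show ?case
  proof (cases t)
    case Leaf
    then show ?thesis using unpair_Leaf[OF cM c(2)] by simp
  next
    case (Node t1 t2)
    have "App (select N (M # Ms)) (tree_trm t) \<leadsto>* App (App ?M (tree_trm t1)) (tree_trm t2)"
      using unpair_Node[OF cM c(2)] Node by simp
    also have "\<dots> \<leadsto>* App (select N Ms) (tree_trm t1)"
      by (rule reds_beta_eq | rule reds_App_beta | simp add: c)+
    also have "\<dots> \<leadsto>* (if left_depth t1 < length Ms then Ms ! left_depth t1 else N)"
      by (rule less)
    finally show ?thesis by (simp only: Node left_depth.simps list.size Suc_less_eq nth_Cons_Suc add_Suc_right add_0_right)
  qed
qed

subsection \<open>Simulation of a machine\<close>

lemma closed_Lam_leaf [simp]: "closed_trm (Lam leaf)"
  by (rule closedI) simp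

lemma typed_Lam_leaf: "typed D (Lam leaf) (A \<multimap> tree m)"
  by (rule uses_Nil, rule uses_Lam, rule uses_closed, rule typed_leaf) simp

abbreviation num_trm :: "nat \<Rightarrow> 'c trm" where
  "num_trm n \<equiv> tree_trm (num n)"

text \<open>
  A configuration is the tree \<open>((q, (a, r)), l)\<close>, where \<open>a\<close> is the scanned symbol, \<open>r\<close> lists the
  symbols to its right and \<open>l\<close> those to its left, starting from the head. The three terms below
  take \<open>r\<close> and \<open>l\<close> and return the configuration with new state \<open>q\<close> and written symbol \<open>a\<close> in
  which the head stays, moves right, or moves left.
\<close>

definition head_stay :: "nat \<Rightarrow> nat \<Rightarrow> 'c trm" where
  "head_stay q a = Lam (Lam (node (node (num_trm q) (node (num_trm a) (Var (Suc 0)))) (Var 0)))"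

definition head_right :: "nat \<Rightarrow> nat \<Rightarrow> 'c trm" where
  "head_right q a = unpair
     (Lam (Lam (Lam (node (node (num_trm q) (node (Var 2) (Var (Suc 0)))) (node (num_trm a) (Var 0))))))
     (Lam (node (node (num_trm q) (node leaf leaf)) (node (num_trm a) (Var 0))))"

definition head_left :: "nat \<Rightarrow> nat \<Rightarrow> 'c trm" where
  "head_left q a = Lam (Lam (App (App (unpair
     (Lam (Lam (Lam (node (node (num_trm q) (node (Var 2) (node (num_trm a) (Var 0)))) (Var (Suc 0))))))
     (Lam (node (node (num_trm q) (node leaf (node (num_trm a) (Var 0)))) leaf))) (Var 0)) (Var (Suc 0))))"

lemma closed_head [simp]:
  "closed_trm (head_stay q a)" "closed_trm (head_right q a)" "closed_trm (head_left q a)"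
  unfolding head_stay_def head_right_def head_left_def
  by (auto intro!: closedI closed_unpair simp: unpair_def numeral_2_eq_2)

lemma typed_head_stay: "typed D (head_stay q a) (tree m \<multimap> tree m \<multimap> tree m)"
  unfolding head_stay_def
  by (rule uses_Nil)
    (rule uses_Lam uses_node uses_Var uses_closed[OF typed_tree] refl | simp)+

lemma typed_head_right: "typed D (head_right q a) (tree m \<multimap> tree m \<multimap> tree m)"
  unfolding head_right_def
  by (rule typed_unpair; rule uses_Nil)
    (rule uses_Lam uses_node uses_Var uses_closed[OF typed_tree] uses_closed[OF typed_leaf] refl | simp)+

lemma typed_head_left: "typed D (head_left q a) (tree m \<multimap> tree m \<multimap> tree m)"
  unfolding head_left_def
proof -
  let ?M = "Lam (Lam (Lam (node (node (num_trm q) (node (Var 2) (node (num_trm a) (Var 0)))) (Var (Suc 0)))))"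
  let ?N = "Lam (node (node (num_trm q) (node leaf (node (num_trm a) (Var 0)))) leaf)"
  have *: "typed D (unpair ?M ?N) (tree m \<multimap> tree m \<multimap> tree m)"
    by (rule typed_unpair; rule uses_Nil)
      (rule uses_Lam uses_node uses_Var uses_closed[OF typed_tree] uses_closed[OF typed_leaf] refl | simp)+
  show "typed D (Lam (Lam (App (App (unpair ?M ?N) (Var 0)) (Var (Suc 0))))) (tree m \<multimap> tree m \<multimap> tree m)"
    by (rule uses_Nil) (rule uses_Lam uses_App uses_Var uses_closed[OF *] refl | simp)+
qed

lemma head_stay_reds:
  "App (App (head_stay q a) (tree_trm r)) (tree_trm l)
    \<leadsto>* tree_trm (Node (Node (num q) (Node (num a) r)) l)"
  unfolding head_stay_def
  by (rule reds_beta_eq | rule reds_App_beta | simp)+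

text \<open>A blank is supplied when \<open>r\<close> is exhausted: \<open>node leaf leaf\<close> is
  the one-element stack holding symbol 0.\<close>

lemma head_right_reds:
  "App (App (head_right q a) (tree_trm (stack r))) (tree_trm l)
    \<leadsto>* tree_trm (Node (Node (num q) (stack (case r of [] \<Rightarrow> [0] | _ \<Rightarrow> r))) (Node (num a) l))"
proof -
  let ?M = "Lam (Lam (Lam (node (node (num_trm q) (node (Var 2) (Var (Suc 0)))) (node (num_trm a) (Var 0)))))"
  let ?N = "Lam (node (node (num_trm q) (node leaf leaf)) (node (num_trm a) (Var 0)))"
  have c: "closed_trm ?M" "closed_trm ?N"
    by (rule closedI; simp add: numeral_2_eq_2)+
  show ?thesis
  proof (cases r)
    case Nil
    have "App (App (head_right q a) (tree_trm (stack r))) (tree_trm l) \<leadsto>* App ?N (tree_trm l)"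
      unfolding head_right_def Nil stack.simps
      by (rule reds_App[OF unpair_Leaf[OF c] rtranclp.rtrancl_refl])
    also have "\<dots> \<leadsto>* tree_trm (Node (Node (num q) (stack [0])) (Node (num a) l))"
      by (rule reds_beta_eq | rule reds_App_beta | simp)+
    finally show ?thesis unfolding Nil list.case .
  next
    case (Cons b r')
    have "App (App (head_right q a) (tree_trm (stack r))) (tree_trm l)
        \<leadsto>* App (App (App ?M (num_trm b)) (tree_trm (stack r'))) (tree_trm l)"
      unfolding head_right_def Cons stack.simps
      by (rule reds_App[OF unpair_Node[OF c] rtranclp.rtrancl_refl])
    also have "\<dots> \<leadsto>* tree_trm (Node (Node (num q) (stack (b # r'))) (Node (num a) l))"
      by (rule reds_beta_eq | rule reds_App_beta | simp add: numeral_2_eq_2)+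
    finally show ?thesis unfolding Cons list.case .
  qed
qed

text \<open>Here it is \<open>l\<close> that has to be split. Since \<open>unpair\<close> inspects
  its first argument, the two arguments are exchanged first.\<close>

lemma head_left_reds:
  "App (App (head_left q a) (tree_trm r)) (tree_trm (stack l))
    \<leadsto>* tree_trm (Node (Node (num q)
          (Node (num (case l of [] \<Rightarrow> 0 | b # _ \<Rightarrow> b)) (Node (num a) r))) (stack (tl l)))"
proof -
  let ?M = "Lam (Lam (Lam (node (node (num_trm q) (node (Var 2) (node (num_trm a) (Var 0)))) (Var (Suc 0)))))"
  let ?N = "Lam (node (node (num_trm q) (node leaf (node (num_trm a) (Var 0)))) leaf)"
  have c: "closed_trm ?M" "closed_trm ?N"
    by (rule closedI; simp add: numeral_2_eq_2)+
  have "App (App (head_left q a) (tree_trm r)) (tree_trm (stack l))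
      \<leadsto>* App (App (unpair ?M ?N) (tree_trm (stack l))) (tree_trm r)"
    unfolding head_left_def
    by (rule reds_beta_eq | rule reds_App_beta | simp add: closed_unpair[OF c])+
  also have "\<dots> \<leadsto>* tree_trm (Node (Node (num q)
          (Node (num (case l of [] \<Rightarrow> 0 | b # _ \<Rightarrow> b)) (Node (num a) r))) (stack (tl l)))"
  proof (cases l)
    case Nil
    have "App (App (unpair ?M ?N) (tree_trm (stack l))) (tree_trm r) \<leadsto>* App ?N (tree_trm r)"
      unfolding Nil stack.simps
      by (rule reds_App[OF unpair_Leaf[OF c] rtranclp.rtrancl_refl])
    also have "\<dots> \<leadsto>* tree_trm (Node (Node (num q) (Node (num 0) (Node (num a) r))) (stack []))"
      by (rule reds_beta_eq | rule reds_App_beta | simp)+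
    finally show ?thesis unfolding Nil list.case list.sel .
  next
    case (Cons b l')
    have "App (App (unpair ?M ?N) (tree_trm (stack l))) (tree_trm r)
        \<leadsto>* App (App (App ?M (num_trm b)) (tree_trm (stack l'))) (tree_trm r)"
      unfolding Cons stack.simps
      by (rule reds_App[OF unpair_Node[OF c] rtranclp.rtrancl_refl])
    also have "\<dots> \<leadsto>* tree_trm (Node (Node (num q) (Node (num b) (Node (num a) r))) (stack l'))"
      by (rule reds_beta_eq | rule reds_App_beta | simp add: numeral_2_eq_2)+
    finally show ?thesis unfolding Cons list.case list.sel .
  qed
  finally show ?thesis .
qed

text \<open>In a halting configuration \<open>head_stay q a\<close> writes the scanned symbol back,
  so a clock that runs too long does no harm.\<close>

definition action :: "tm \<Rightarrow> nat \<Rightarrow> nat \<Rightarrow> 'c trm" where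
  "action T q a =
     (case delta T q a of
        None \<Rightarrow> head_stay q a
      | Some (q', b, d) \<Rightarrow>
          (case d of MLeft \<Rightarrow> head_left q' b | MRight \<Rightarrow> head_right q' b | MStay \<Rightarrow> head_stay q' b))"

lemma closed_action [simp]: "closed_trm (action T q a)"
  by (auto simp: action_def split: option.split move.split)

lemma typed_action: "typed D (action T q a) (tree m \<multimap> tree m \<multimap> tree m)"
  by (auto simp: action_def typed_head_stay typed_head_left typed_head_right
      split: option.split move.split)

text \<open>\<open>head_stay 0 0\<close> and \<open>Lam leaf\<close> are defaults of the right type;
  in a configuration tree a symbol in range leads to an entry of the list.\<close>

definition state_trm :: "tm \<Rightarrow> nat \<Rightarrow> 'c trm" where
  "state_trm T q =
     unpair (select (head_stay 0 0) (map (action T q) [0..<nsymbols T])) (Lam leaf)"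

lemma closed_state_trm [simp]: "closed_trm (state_trm T q)"
  unfolding state_trm_def by (rule closed_unpair) auto

lemma typed_state_trm: "typed D (state_trm T q) (tree m \<multimap> tree m \<multimap> tree m)"
  unfolding state_trm_def
  by (rule typed_unpair[OF typed_select typed_Lam_leaf]) (auto intro: typed_head_stay typed_action)

definition step_trm :: "tm \<Rightarrow> 'c trm" where
  "step_trm T =
     unpair (unpair (select (head_stay 0 0) (map (state_trm T) [0..<nstates T])) (Lam leaf)) leaf"

lemma closed_step_trm [simp]: "closed_trm (step_trm T)"
  unfolding step_trm_def by (intro closed_unpair closed_select) auto

text \<open>Only conditionals occur, and they hand out subtrees at the level of the scrutinee, so
  argument and result share the level \<open>m\<close>. A recursion on the configuration would force
  the result to a lower level, and the step could not be iterated.\<close>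

lemma typed_step_trm: "typed D (step_trm T) (tree m \<multimap> tree m)"
  unfolding step_trm_def
  by (rule typed_unpair[OF typed_unpair[OF typed_select typed_Lam_leaf] typed_leaf])
    (auto intro: typed_head_stay typed_state_trm)

end

section \<open>The tape as two lists around the head\<close>

type_synonym list_config = "nat \<times> nat list \<times> nat \<times> nat list"

fun list_step :: "tm \<Rightarrow> list_config \<Rightarrow> list_config" where
  "list_step T (q, l, a, r) =
     (case delta T q a of
        None \<Rightarrow> (q, l, a, r)
      | Some (q', b, MStay) \<Rightarrow> (q', l, b, r)
      | Some (q', b, MRight) \<Rightarrow> (q', b # l, (case r of [] \<Rightarrow> 0 | c # _ \<Rightarrow> c), tl r)
      | Some (q', b, MLeft) \<Rightarrow> (q', tl l, (case l of [] \<Rightarrow> 0 | c # _ \<Rightarrow> c), b # r))"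

fun config_tree :: "list_config \<Rightarrow> btree" where
  "config_tree (q, l, a, r) = Node (Node (num q) (Node (num a) (stack r))) (stack l)"

text \<open>The default 0 is the blank, so a finite list stands for a half-infinite tape.\<close>

definition symbol_at :: "nat list \<Rightarrow> nat \<Rightarrow> nat" where
  "symbol_at l i = (if i < length l then l ! i else 0)"

lemma symbol_at_simps [simp]:
  "symbol_at [] i = 0" "symbol_at (a # l) 0 = a" "symbol_at (a # l) (Suc i) = symbol_at l i"
  "symbol_at (tl l) i = symbol_at l (Suc i)"
  by (auto simp: symbol_at_def nth_tl)

lemma case_list_symbol_at: "(case l of [] \<Rightarrow> 0 | c # _ \<Rightarrow> c) = symbol_at l 0"
  by (cases l) auto

text \<open>Besides matching both halves of the tape, the invariant keeps states and symbols in
  range, which \<open>select\<close> needs to find their entries.\<close>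

fun simulates :: "tm \<Rightarrow> tm_config \<Rightarrow> list_config \<Rightarrow> bool" where
  "simulates T (q, tp, h) (q', l, a, r) \<longleftrightarrow>
     q' = q \<and> q < nstates T \<and> (\<forall>i. tp i < nsymbols T) \<and> tp h = a \<and>
     (\<forall>i. tp (h + 1 + int i) = symbol_at r i) \<and> (\<forall>i. tp (h - 1 - int i) = symbol_at l i)"

lemma simulates_step:
  assumes "wf_tm T" "simulates T c k"
  shows "simulates T (tm_step T c) (list_step T k)"
proof -
  obtain q tp h where c: "c = (q, tp, h)" by (cases c)
  obtain l a r where k: "k = (q, l, a, r)" using assms(2) c by (cases k) auto
  have *: "q < nstates T" "\<And>i. tp i < nsymbols T" "tp h = a"
    "\<And>i. tp (h + 1 + int i) = symbol_at r i" "\<And>i. tp (h - 1 - int i) = symbol_at l i"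
    using assms(2) c k by auto
  show ?thesis
  proof (cases "delta T q a")
    case None
    then show ?thesis using assms(2) c k * by simp
  next
    case (Some x)
    then obtain q' b d where d: "delta T q a = Some (q', b, d)" by (cases x) auto
    then have wf: "q' < nstates T" "b < nsymbols T"
      using assms(1) *(1) *(2)[of h] *(3) unfolding wf_tm_def by blast+
    show ?thesis
    proof (cases d)
      case MStay
      then show ?thesis using c k d * wf by simp
    next
      case MRight
      have "(tp(h := b)) (h + 1 + 1 + int i) = symbol_at (tl r) i" for i
        using *(4)[of "Suc i"] by (simp add: algebra_simps)
      \<comment> \<open>The cell just left by the head holds \<open>b\<close>; all others shift by
        one index. For \<open>i = 0\<close> the instance \<open>i - 1\<close> is a harmless
        0.\<close>
      moreover have "(tp(h := b)) (h + 1 - 1 - int i) = symbol_at (b # l) i" for i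
        using *(5)[of "i - 1"] by (cases i) (simp_all add: algebra_simps)
      ultimately show ?thesis using MRight c k d *(2,3) *(4)[of 0] wf
        by (simp add: case_list_symbol_at)
    next
      case MLeft
      have "(tp(h := b)) (h - 1 - 1 - int i) = symbol_at (tl l) i" for i
        using *(5)[of "Suc i"] by (simp add: algebra_simps)
      moreover have "(tp(h := b)) (h - 1 + 1 + int i) = symbol_at (b # r) i" for i
        using *(4)[of "i - 1"] by (cases i) (simp_all add: algebra_simps)
      ultimately show ?thesis using MLeft c k d *(2,3) *(5)[of 0] wf
        by (simp add: case_list_symbol_at)
    qed
  qed
qed

text \<open>The left list is \<open>[0]\<close> because \<open>machine_trm\<close> produces the
  start configuration by \<open>head_right 0 0\<close>: the head steps onto the input from a
  blank.\<close>

fun initial :: "bool list \<Rightarrow> list_config" where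
  "initial s = (0, [0], (case s of [] \<Rightarrow> 0 | b # _ \<Rightarrow> letter b), map letter (tl s))"

lemma simulates_initial:
  assumes "wf_tm T"
  shows "simulates T (tm_init s) (initial s)"
proof -
  have "letter b < nsymbols T" "0 < nsymbols T" for b
    using assms by (auto simp: wf_tm_def letter_def)
  moreover have "symbol_at [0] i = 0" for i
    by (simp add: symbol_at_def)
  ultimately show ?thesis using assms
    by (cases s) (auto simp: tm_init_def wf_tm_def symbol_at_def nth_Cons' nat_add_distrib)
qed

lemma halted_funpow:
  assumes "tm_halted T ((tm_step T ^^ t) k)" "t \<le> t'"
  shows "(tm_step T ^^ t') k = (tm_step T ^^ t) k"
  using assms(2)
proof (induction t' rule: dec_induct)
  case (step t')
  obtain q tp h where "(tm_step T ^^ t) k = (q, tp, h)" by (cases "(tm_step T ^^ t) k")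
  then show ?case using step assms(1) by simp
qed simp

text \<open>Stops at the first label other than 1 and 2, in agreement with the output convention. It
  is defined on all trees because the recursion in \<open>write_trm\<close> evaluates the labels
  themselves too.\<close>

primrec decode :: "btree \<Rightarrow> bool list" where
  "decode Leaf = []"
| "decode (Node a r) =
     (if left_depth a = 1 then False # decode r else if left_depth a = 2 then True # decode r else [])"

lemma decode_stack:
  assumes "\<forall>i < length w. symbol_at l i = letter (w ! i)" "symbol_at l (length w) = 0"
  shows "decode (stack l) = w"
  using assms
proof (induction w arbitrary: l)
  case Nil
  then show ?case by (cases l) auto
next
  case (Cons b w)
  have "symbol_at l 0 = letter b" using Cons.prems(1) by force
  then obtain r where l: "l = letter b # r"
    by (cases l) (auto simp: letter_def split: if_splits)
  have "decode (stack r) = w"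
    using Cons.prems l by (intro Cons.IH) force+
  then show ?case by (simp add: l letter_def)
qed

context free_algebras
begin

lemma step_trm_reds:
  assumes "q < nstates T" "a < nsymbols T"
  shows "App (step_trm T) (tree_trm (config_tree (q, l, a, r)))
    \<leadsto>* tree_trm (config_tree (list_step T (q, l, a, r)))"
proof -
  let ?A = "select (head_stay 0 0) (map (action T q) [0..<nsymbols T])"
  let ?Q = "select (head_stay 0 0) (map (state_trm T) [0..<nstates T])"
  have A: "closed_trm ?A" and Q: "closed_trm ?Q" by (rule closed_select; auto)+
  let ?z = "Node (num a) (stack r)"
  have "App (step_trm T) (tree_trm (config_tree (q, l, a, r)))
      \<leadsto>* App (App (unpair ?Q (Lam leaf)) (tree_trm (Node (num q) ?z))) (tree_trm (stack l))"
    unfolding step_trm_def config_tree.simps using Q by (intro unpair_Node) auto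
  also have "\<dots> \<leadsto>* App (App (App ?Q (num_trm q)) (tree_trm ?z)) (tree_trm (stack l))"
    by (intro reds_App[OF _ rtranclp.rtrancl_refl] unpair_Node Q closed_Lam_leaf)
  also have "\<dots> \<leadsto>* App (App (state_trm T q) (tree_trm ?z)) (tree_trm (stack l))"
  proof (intro reds_App rtranclp.rtrancl_refl)
    show "App ?Q (num_trm q) \<leadsto>* state_trm T q"
      using select_reds[of "head_stay 0 0" "map (state_trm T) [0..<nstates T]" "num q"] assms(1)
      by auto
  qed
  also have "\<dots> \<leadsto>* App (App (App ?A (num_trm a)) (tree_trm (stack r))) (tree_trm (stack l))"
    unfolding state_trm_def
    by (intro reds_App[OF _ rtranclp.rtrancl_refl] unpair_Node A closed_Lam_leaf)
  also have "\<dots> \<leadsto>* App (App (action T q a) (tree_trm (stack r))) (tree_trm (stack l))"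
  proof (intro reds_App rtranclp.rtrancl_refl)
    show "App ?A (num_trm a) \<leadsto>* action T q a"
      using select_reds[of "head_stay 0 0" "map (action T q) [0..<nsymbols T]" "num a"] assms(2)
      by auto
  qed
  also have "\<dots> \<leadsto>* tree_trm (config_tree (list_step T (q, l, a, r)))"
  proof (cases "delta T q a")
    case None
    then show ?thesis using head_stay_reds[of q a "stack r" "stack l"] by (simp add: action_def)
  next
    case (Some x)
    then obtain q' b d where d: "delta T q a = Some (q', b, d)" by (cases x) auto
    show ?thesis
    proof (cases d)
      case MStay
      then show ?thesis
        using d head_stay_reds[of q' b "stack r" "stack l"] by (simp add: action_def)
    next
      case MRight
      then show ?thesis
        using d head_right_reds[of q' b "r" "stack l"]
        by (cases r) (simp_all add: action_def)
    next
      case MLeft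
      then show ?thesis
        using d head_left_reds[of q' b "stack r" "l"] by (simp add: action_def)
    qed
  qed
  finally show ?thesis .
qed

subsection \<open>Clocks\<close>

text \<open>\<open>M\<close> denotes a function moving \<open>j\<close> places along the sequence
  \<open>e\<close>. It must reach a value, as only values are passed on by a beta step; closedness
  keeps that value fixed under substitution, and the quantifier over \<open>i\<close> lets advances
  compose.\<close>

definition advances :: "(nat \<Rightarrow> btree) \<Rightarrow> nat \<Rightarrow> 'c trm \<Rightarrow> bool" where
  "advances e j M \<longleftrightarrow> (\<exists>V. M \<leadsto>* V \<and> val V \<and> closed_trm V \<and>
     (\<forall>i. App V (tree_trm (e i)) \<leadsto>* tree_trm (e (i + j))))"

lemma advances_reds: "M \<leadsto>* N \<Longrightarrow> advances e j N \<Longrightarrow> advances e j M"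
  unfolding advances_def by (meson reds_trans)

lemma advances_App: "advances e j M \<Longrightarrow> App M (tree_trm (e i)) \<leadsto>* tree_trm (e (i + j))"
  unfolding advances_def by (meson reds_trans reds_App rtranclp.rtrancl_refl)

lemma advances_id: "advances e 0 (Lam (Var 0))"
  unfolding advances_def
proof (intro exI conjI allI)
  show "Lam (Var 0) \<leadsto>* Lam (Var 0)" by simp
  show "val (Lam (Var 0))" "closed_trm (Lam (Var 0))" by (auto intro: closedI)
  show "App (Lam (Var 0)) (tree_trm (e i)) \<leadsto>* tree_trm (e (i + 0))" for i
    by (rule reds_beta_eq) simp_all
qed

text \<open>
  Recursion hands over both a subtree \<open>t\<close> and the result on it. Running the clock \<open>P\<close> on \<open>t\<close>
  besides that result turns the number of steps \<open>n choose k\<close> into \<open>n choose Suc k\<close> without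
  contraction.
\<close>

primrec binomial_clock :: "'c trm \<Rightarrow> nat \<Rightarrow> 'c trm" where
  "binomial_clock S 0 = Lam S"
| "binomial_clock S (Suc k) = Lam (Rec (Var 0)
     [Lam (Lam (Lam (Lam (Lam (App (App (binomial_clock S k) (Var 4)) (App (Var 2) (Var 0))))))),
      Lam (Var 0)])"

lemma closed_binomial_clock [simp]:
  assumes "closed_trm S"
  shows "closed_trm (binomial_clock S k)"
proof (induction k)
  case 0
  show ?case by (rule closedI) (simp add: assms)
next
  case (Suc k)
  then show ?case by (intro closedI) (simp add: eval_nat_numeral)
qed

text \<open>The predecessor is passed on at the level \<open>m\<close> of the scrutinee, so the
  inner clock can recurse on it again: nesting does not raise the level. Every variable occurs at
  most once, so any \<open>D\<close> will do.\<close>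

lemma typed_binomial_clock:
  assumes "typed D S (tree n \<multimap> tree n)" "n < m"
  shows "typed D (binomial_clock S k) (tree m \<multimap> tree n \<multimap> tree n)"
proof (induction k)
  case 0
  show ?case unfolding binomial_clock.simps
    by (rule uses_Nil, rule uses_Lam, rule uses_closed[OF assms(1)]) simp
next
  case (Suc k)
  let ?M = "Lam (Lam (Lam (Lam (Lam (App (App (binomial_clock S k) (Var 4)) (App (Var 2) (Var 0)))))))"
  have M: "typed D ?M (tree m \<multimap> tree m \<multimap>
      (tree n \<multimap> tree n) \<multimap> (tree n \<multimap> tree n) \<multimap> tree n \<multimap> tree n)"
    by (rule uses_Nil)
      (rule uses_Lam uses_App uses_Var uses_closed[OF Suc] refl | simp add: eval_nat_numeral)+
  have N: "typed D (Lam (Var 0)) (tree n \<multimap> tree n)"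
    by (rule uses_Nil) (rule uses_Lam uses_Var refl | simp)+
  show ?case unfolding binomial_clock.simps
    by (rule uses_Nil, rule uses_Lam, rule uses_Rec_tree[OF M N], rule uses_Var)
      (use assms(2) in auto)
qed

text \<open>Pascal's rule: at \<open>Suc n\<close> the \<open>n choose k\<close> steps of the inner
  clock on \<open>n\<close> are added to the \<open>n choose Suc k\<close> steps obtained by the
  recursion.\<close>

lemma advances_binomial_clock:
  assumes S: "closed_trm S" "advances e 1 S"
  shows "advances e (n choose k) (App (binomial_clock S k) (num_trm n))"
proof (induction k arbitrary: n)
  case 0
  have "App (binomial_clock S 0) (num_trm n) \<leadsto>* S"
    unfolding binomial_clock.simps by (rule reds_beta_eq) (simp_all add: S)
  then show ?case using S(2) advances_reds by simp
next
  case (Suc k)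
  note outer = Suc
  let ?B = "binomial_clock S k"
  let ?M = "Lam (Lam (Lam (Lam (Lam (App (App ?B (Var 4)) (App (Var 2) (Var 0)))))))"
  let ?N = "Lam (Var 0) :: 'c trm"
  have B: "closed_trm ?B" using S(1) by simp
  have "advances e (n choose Suc k) (Rec (num_trm n) [?M, ?N])" for n
  proof (induction n)
    case 0
    show ?case using advances_reds[OF Rec_leaf advances_id] by simp
  next
    case (Suc n)
    then obtain V where V: "Rec (num_trm n) [?M, ?N] \<leadsto>* V" "val V" "closed_trm V"
      "\<And>i. App V (tree_trm (e i)) \<leadsto>* tree_trm (e (i + (n choose Suc k)))"
      unfolding advances_def by blast
    \<comment> \<open>The recursion supplies four of the five arguments of \<open>?M\<close>, so
      reduction stops at the abstraction of \<open>?W\<close>, a value waiting for the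
      datum.\<close>
    let ?W = "App (App ?B (num_trm n)) (App V (Var 0))"
    have "Rec (num_trm (Suc n)) [?M, ?N]
        \<leadsto>* App (App (App (App ?M (num_trm n)) leaf) V) ?N"
      unfolding num.simps tree_trm.simps by (rule Rec_node[OF _ _ V(1) Rec_leaf]) simp_all
    also have "\<dots> \<leadsto>* Lam ?W"
      by (rule reds_beta_eq | rule reds_App_beta | simp add: V B eval_nat_numeral)+
    finally have "Rec (num_trm (Suc n)) [?M, ?N] \<leadsto>* Lam ?W" .
    moreover have "closed_trm (Lam ?W)"
      by (rule closedI) (simp add: V B)
    moreover have "App (Lam ?W) (tree_trm (e i)) \<leadsto>* tree_trm (e (i + (Suc n choose Suc k)))" for i
    proof -
      have "App (Lam ?W) (tree_trm (e i)) \<leadsto>* App (App ?B (num_trm n)) (App V (tree_trm (e i)))"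
        by (rule reds_beta_eq) (simp_all add: V B)
      also have "\<dots> \<leadsto>* App (App ?B (num_trm n)) (tree_trm (e (i + (n choose Suc k))))"
        by (rule reds_App[OF rtranclp.rtrancl_refl V(4)])
      also have "\<dots> \<leadsto>* tree_trm (e (i + (n choose Suc k) + (n choose k)))"
        by (rule advances_App[OF outer])
      finally show ?thesis by (simp add: ac_simps)
    qed
    moreover have "val (Lam ?W)" by simp
    ultimately show ?case unfolding advances_def by blast
  qed
  moreover have "App (binomial_clock S (Suc k)) (num_trm n) \<leadsto>* Rec (num_trm n) [?M, ?N]"
    unfolding binomial_clock.simps by (rule reds_beta_eq) (simp_all add: B eval_nat_numeral)
  ultimately show ?case by (metis advances_reds)
qed

section \<open>Iteration once per leaf and towers of exponentials\<close>

text \<open>A leaf yields \<open>S\<close>, a node the composition of the functions obtained on its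
  children. Each of these is used once, so no contraction is involved.\<close>

definition iterate :: "'c trm \<Rightarrow> 'c trm" where
  "iterate S = Lam (Rec (Var 0)
     [Lam (Lam (Lam (Lam (Lam (App (Var 2) (App (Var (Suc 0)) (Var 0))))))), S])"

lemma closed_iterate [simp]: "closed_trm S \<Longrightarrow> closed_trm (iterate S)"
  by (rule closedI) (simp add: iterate_def eval_nat_numeral)

lemma typed_iterate:
  assumes "typed D S (tree n \<multimap> tree n)" "n < m"
  shows "typed D (iterate S) (tree m \<multimap> tree n \<multimap> tree n)"
proof -
  have M: "typed D (Lam (Lam (Lam (Lam (Lam (App (Var 2) (App (Var (Suc 0)) (Var 0)))))))) (tree m \<multimap> tree m \<multimap>
      (tree n \<multimap> tree n) \<multimap> (tree n \<multimap> tree n) \<multimap> tree n \<multimap> tree n)"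
    by (rule uses_Nil)
      (rule uses_Lam uses_App uses_Var refl | simp add: eval_nat_numeral)+
  show ?thesis unfolding iterate_def
    by (rule uses_Nil, rule uses_Lam, rule uses_Rec_tree[OF M assms(1)], rule uses_Var)
      (use assms(2) in auto)
qed

lemma advances_iterate:
  assumes S: "closed_trm S" "advances e 1 S"
  shows "advances e (leaves t) (App (iterate S) (tree_trm t))"
proof -
  let ?M = "Lam (Lam (Lam (Lam (Lam (App (Var 2) (App (Var (Suc 0)) (Var 0)))))))"
  have "advances e (leaves t) (Rec (tree_trm t) [?M, S])"
  proof (induction t)
    case Leaf
    show ?case using advances_reds[OF Rec_leaf S(2)] by simp
  next
    case (Node s t)
    from Node.IH(1) obtain V where V: "Rec (tree_trm s) [?M, S] \<leadsto>* V" "val V" "closed_trm V"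
      "\<And>i. App V (tree_trm (e i)) \<leadsto>* tree_trm (e (i + leaves s))"
      unfolding advances_def by blast
    from Node.IH(2) obtain W where W: "Rec (tree_trm t) [?M, S] \<leadsto>* W" "val W" "closed_trm W"
      "\<And>i. App W (tree_trm (e i)) \<leadsto>* tree_trm (e (i + leaves t))"
      unfolding advances_def by blast
    let ?N = "App V (App W (Var 0))"
    have "Rec (tree_trm (Node s t)) [?M, S]
        \<leadsto>* App (App (App (App ?M (tree_trm s)) (tree_trm t)) V) W"
      unfolding tree_trm.simps by (rule Rec_node[OF _ _ V(1) W(1)]) simp_all
    also have "\<dots> \<leadsto>* Lam ?N"
      by (rule reds_beta_eq | rule reds_App_beta | simp add: V W eval_nat_numeral)+
    finally have "Rec (tree_trm (Node s t)) [?M, S] \<leadsto>* Lam ?N" .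
    moreover have "val (Lam ?N)" "closed_trm (Lam ?N)"
      by (auto intro: closedI simp: V W)
    moreover have "App (Lam ?N) (tree_trm (e i)) \<leadsto>* tree_trm (e (i + leaves (Node s t)))" for i
    proof -
      have "App (Lam ?N) (tree_trm (e i)) \<leadsto>* App V (App W (tree_trm (e i)))"
        by (rule reds_beta_eq) (simp_all add: V W)
      also have "\<dots> \<leadsto>* App V (tree_trm (e (i + leaves t)))"
        by (rule reds_App[OF rtranclp.rtrancl_refl W(4)])
      also have "\<dots> \<leadsto>* tree_trm (e (i + leaves t + leaves s))"
        by (rule V(4))
      finally show ?thesis by (simp add: ac_simps)
    qed
    ultimately show ?case unfolding advances_def by blast
  qed
  moreover have "App (iterate S) (tree_trm t) \<leadsto>* Rec (tree_trm t) [?M, S]"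
    unfolding iterate_def by (rule reds_beta_eq) (simp_all add: S eval_nat_numeral)
  ultimately show ?thesis by (metis advances_reds)
qed

definition double :: "'c trm" where
  "double = Lam (node (Var 0) (Var 0))"

lemma closed_double [simp]: "closed_trm double"
  by (rule closedI) (simp add: double_def)

text \<open>Here contraction enters, at a base type: the linear body with two variables is typed
  first, and both are then merged into index 0, ready to be bound.\<close>

lemma typed_double: "typed base_types double (tree n \<multimap> tree n)"
proof -
  let ?M = "node (Var 0) (Var (Suc 0)) :: 'c trm"
  have "uses F base_types [tree n, tree n] ({0} \<union> {Suc 0}) ?M (tree n)"
    by (rule uses_node; (rule uses_Var)?) simp_all
  moreover have "ctx_of [tree n, tree n] ({0} \<union> {Suc 0}) = [0 \<mapsto> tree n, Suc 0 \<mapsto> tree n]"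
    by (auto simp: ctx_of_def less_Suc_eq)
  ultimately have "RH F base_types (Map.empty(0 \<mapsto> tree n, Suc 0 \<mapsto> tree n)) ?M (tree n)"
    unfolding uses_def by (simp only:)
  then have "RH F base_types (Map.empty(0 \<mapsto> tree n))
      (rename (\<lambda>v. if v = 0 \<or> v = Suc 0 then 0 else v) ?M) (tree n)"
    by (rule RH.contr) (auto simp: base_types_def)
  moreover have "[0 \<mapsto> tree n] = case_nat (Some (tree n)) Map.empty"
    by (auto split: nat.split)
  ultimately show ?thesis
    unfolding double_def by (intro RH.abs) (simp only: rename.simps simp_thms if_True)
qed

lemma advances_double: "advances full 1 double"
  unfolding advances_def
proof (intro exI conjI allI)
  show "double \<leadsto>* double" "closed_trm double" by simp_all
  show "val double" by (simp add: double_def)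
  show "App double (tree_trm (full i)) \<leadsto>* tree_trm (full (i + 1))" for i
    unfolding double_def by (rule reds_beta_eq) simp_all
qed

definition exponential :: "'c trm" where
  "exponential = Lam (App (App (iterate double) (Var 0)) leaf)"

lemma closed_exponential [simp]: "closed_trm exponential"
  by (rule closedI) (simp add: exponential_def)

text \<open>Doubling is iterated by recursion on the argument, whose level must exceed that of the
  result; each exponential therefore costs one level.\<close>

lemma typed_exponential:
  assumes "n < m"
  shows "typed base_types exponential (tree m \<multimap> tree n)"
  unfolding exponential_def
  by (rule uses_Nil)
    (rule uses_Lam uses_App uses_Var uses_closed[OF typed_iterate[OF typed_double assms]]
      uses_closed[OF typed_leaf] refl | simp)+

text \<open>Starting from \<open>leaf\<close>, which is \<open>full 0\<close>, one doubling per leaf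
  of \<open>t\<close> gives depth \<open>leaves t\<close>, hence \<open>2 ^ leaves t\<close>
  leaves.\<close>

lemma exponential_reds: "App exponential (tree_trm t) \<leadsto>* tree_trm (full (leaves t))"
proof -
  have "App exponential (tree_trm t) \<leadsto>* App (App (iterate double) (tree_trm t)) (tree_trm (full 0))"
    unfolding exponential_def by (rule reds_beta_eq) simp_all
  also have "\<dots> \<leadsto>* tree_trm (full (0 + leaves t))"
    by (rule advances_App[OF advances_iterate[OF closed_double advances_double]])
  finally show ?thesis by simp
qed

primrec tower_clock :: "'c trm \<Rightarrow> nat \<Rightarrow> 'c trm" where
  "tower_clock S 0 = iterate S"
| "tower_clock S (Suc k) = Lam (App (tower_clock S k) (App exponential (Var 0)))"

lemma closed_tower_clock [simp]: "closed_trm S \<Longrightarrow> closed_trm (tower_clock S k)"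
  by (induction k) (auto intro: closedI)

lemma typed_tower_clock:
  assumes "typed base_types S (tree n \<multimap> tree n)" "n < m"
  shows "typed base_types (tower_clock S k) (tree (k + m) \<multimap> tree n \<multimap> tree n)"
proof (induction k)
  case 0
  show ?case using typed_iterate[OF assms] by simp
next
  case (Suc k)
  have e: "typed base_types exponential (tree (Suc k + m) \<multimap> tree (k + m))"
    by (rule typed_exponential) simp
  show ?case unfolding tower_clock.simps
    by (rule uses_Nil)
      (rule uses_Lam uses_App uses_Var uses_closed[OF Suc] uses_closed[OF e] refl | simp)+
qed

lemma advances_tower_clock:
  assumes S: "closed_trm S" "advances e 1 S"
  shows "advances e (tower k (leaves t)) (App (tower_clock S k) (tree_trm t))"
proof (induction k arbitrary: t)
  case 0
  show ?case using advances_iterate[OF S] by simp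
next
  case (Suc k)
  have "App (tower_clock S (Suc k)) (tree_trm t)
      \<leadsto>* App (tower_clock S k) (App exponential (tree_trm t))"
    unfolding tower_clock.simps by (rule reds_beta_eq) (simp_all add: S)
  also have "\<dots> \<leadsto>* App (tower_clock S k) (tree_trm (full (leaves t)))"
    by (rule reds_App[OF rtranclp.rtrancl_refl exponential_reds])
  finally have "advances e (tower k (2 ^ leaves t)) (App (tower_clock S (Suc k)) (tree_trm t))"
    using Suc[of "full (leaves t)"] by (metis advances_reds leaves_full)
  \<comment> \<open>The clock exponentiates its argument first, whereas \<open>tower\<close> adds
    the exponential last; both give the same number.\<close>
  moreover have "tower k (2 ^ n) = tower (Suc k) n" for n
    by (induction k) auto
  ultimately show ?case by (simp only:)
qed

subsection \<open>Input and output\<close>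

text \<open>Rebuilding a tree by recursion copies it to a lower level. The pair delivered by
  \<open>read_trm\<close> has a single level, while the clock input must lie above the
  configuration, so the tape half is lowered.\<close>

definition coerce :: "'c trm" where
  "coerce = Lam (Rec (Var 0) [Lam (Lam (Lam (Lam (node (Var (Suc 0)) (Var 0))))), leaf])"

lemma closed_coerce [simp]: "closed_trm coerce"
  by (rule closedI) (simp add: coerce_def)

lemma typed_coerce:
  assumes "n < m"
  shows "typed D coerce (tree m \<multimap> tree n)"
proof -
  have M: "typed D (Lam (Lam (Lam (Lam (node (Var (Suc 0)) (Var 0))))))
      (tree m \<multimap> tree m \<multimap> tree n \<multimap> tree n \<multimap> tree n)"
    by (rule uses_Nil) (rule uses_Lam uses_node uses_Var refl | simp)+
  show ?thesis unfolding coerce_def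
    by (rule uses_Nil, rule uses_Lam, rule uses_Rec_tree[OF M typed_leaf], rule uses_Var)
      (use assms in auto)
qed

lemma coerce_reds: "App coerce (tree_trm t) \<leadsto>* tree_trm t"
proof -
  let ?M = "Lam (Lam (Lam (Lam (node (Var (Suc 0)) (Var 0)))))"
  have "Rec (tree_trm t) [?M, leaf] \<leadsto>* tree_trm t"
  proof (induction t)
    case Leaf
    show ?case unfolding tree_trm.simps by (rule Rec_leaf)
  next
    case (Node s t)
    have "Rec (tree_trm (Node s t)) [?M, leaf]
        \<leadsto>* App (App (App (App ?M (tree_trm s)) (tree_trm t)) (tree_trm s)) (tree_trm t)"
      unfolding tree_trm.simps by (rule Rec_node[OF _ _ Node.IH]) simp_all
    also have "\<dots> \<leadsto>* tree_trm (Node s t)"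
      by (rule reds_beta_eq | rule reds_App_beta | simp)+
    finally show ?case .
  qed
  moreover have "App coerce (tree_trm t) \<leadsto>* Rec (tree_trm t) [?M, leaf]"
    unfolding coerce_def by (rule reds_beta_eq) simp_all
  ultimately show ?thesis by (metis reds_trans)
qed

text \<open>
  Without contraction the input string can be used only once, so a single recursion over it
  builds both a numeral (its length plus the constant \<open>c\<close>) to drive the clock and the list of its
  letters.
\<close>

definition read_letter :: "bool \<Rightarrow> 'c trm" where
  "read_letter b = Lam (unpair
     (Lam (Lam (node (node (Var (Suc 0)) leaf) (node (num_trm (letter b)) (Var 0))))) leaf)"

definition read_trm :: "nat \<Rightarrow> 'c trm" where
  "read_trm c = Lam (Rec (Var 0) [read_letter False, read_letter True, node (num_trm c) leaf])"

lemma closed_read_letter [simp]: "closed_trm (read_letter b)"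
  by (rule closedI) (simp add: read_letter_def unpair_def)

lemma closed_read_trm [simp]: "closed_trm (read_trm c)"
  by (rule closedI) (simp add: read_trm_def)

lemma typed_read_letter: "typed D (read_letter b) (str m \<multimap> tree n \<multimap> tree n)"
proof -
  have "typed D (Lam (Lam (node (node (Var (Suc 0)) leaf) (node (num_trm (letter b)) (Var 0)))))
      (tree n \<multimap> tree n \<multimap> tree n)"
    by (rule uses_Nil) (rule uses_Lam uses_node uses_Var uses_closed[OF typed_leaf]
      uses_closed[OF typed_tree] refl | simp)+
  note * = typed_unpair[OF this typed_leaf]
  show ?thesis unfolding read_letter_def
    by (rule uses_Nil, rule uses_Lam, rule uses_closed[OF *]) simp
qed

lemma typed_read_trm:
  assumes "n < m"
  shows "typed D (read_trm c) (str m \<multimap> tree n)"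
  unfolding read_trm_def
  by (rule uses_Nil, rule uses_Lam,
      rule uses_Rec_str[OF typed_read_letter typed_read_letter typed_node_App[OF typed_tree typed_leaf]],
      rule uses_Var)
    (use assms in auto)

lemma read_trm_reds:
  "App (read_trm c) (encode F s) \<leadsto>* tree_trm (Node (num (length s + c)) (stack (map letter s)))"
proof -
  let ?Ms = "[read_letter False, read_letter True, node (num_trm c) leaf]"
  have "Rec (encode F s) ?Ms \<leadsto>* tree_trm (Node (num (length s + c)) (stack (map letter s)))"
  proof (induction s)
    case Nil
    have "tree_trm (Node (num (length [] + c)) (stack (map letter []))) = node (num_trm c) leaf"
      by simp
    then show ?case using Rec_eps by metis
  next
    case (Cons b s)
    let ?x = "Node (num (length s + c)) (stack (map letter s))"
    let ?M = "Lam (Lam (node (node (Var (Suc 0)) leaf) (node (num_trm (letter b)) (Var 0))))"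
    have M: "closed_trm ?M" "closed_trm leaf" by (rule closedI, simp)+
    have "Rec (encode F (b # s)) ?Ms \<leadsto>* App (App (read_letter b) (encode F s)) (tree_trm ?x)"
      using Rec_letter[OF Cons, of b] by (cases b) simp_all
    also have "\<dots> \<leadsto>* App (unpair ?M leaf) (tree_trm ?x)"
      unfolding read_letter_def
      by (intro reds_App[OF _ rtranclp.rtrancl_refl] reds_beta_eq) (simp_all add: closed_unpair[OF M])
    also have "\<dots> \<leadsto>* App (App ?M (num_trm (length s + c))) (tree_trm (stack (map letter s)))"
      by (rule unpair_Node[OF M])
    also have "\<dots> \<leadsto>* tree_trm (Node (num (length (b # s) + c)) (stack (map letter (b # s))))"
      by (rule reds_beta_eq | rule reds_App_beta | simp)+
    finally show ?case .
  qed
  moreover have "App (read_trm c) (encode F s) \<leadsto>* Rec (encode F s) ?Ms"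
    unfolding read_trm_def by (rule reds_beta_eq) simp_all
  ultimately show ?thesis by (metis reds_trans)
qed

abbreviation eps :: "'c trm" where
  "eps \<equiv> encode F []"

definition cons_trm :: "bool \<Rightarrow> 'c trm" where
  "cons_trm b = Lam (App (Con (constrs F (algB F) ! (if b then 1 else 0))) (Var 0))"

text \<open>The string built so far comes from the cells further right, so discarding it at a blank
  cuts the output at the first blank. Symbols above 2 are treated alike.\<close>

definition write_symbol :: "'c trm" where
  "write_symbol = select (Lam eps) [Lam eps, cons_trm False, cons_trm True]"

definition write_trm :: "'c trm" where
  "write_trm = Lam (Rec (Var 0)
     [Lam (Lam (Lam (Lam (App (App write_symbol (Var 3)) (Var 0))))), eps])"

lemma closed_write_symbol [simp]: "closed_trm write_symbol"
  unfolding write_symbol_def cons_trm_def by (rule closed_select) (auto intro!: closedI)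

lemma closed_write_trm [simp]: "closed_trm write_trm"
  by (rule closedI) (simp add: write_trm_def eval_nat_numeral)

lemma typed_write_symbol: "typed D write_symbol (tree m \<multimap> str n \<multimap> str n)"
proof -
  have 1: "typed D (Lam eps) (str n \<multimap> str n)"
    by (rule uses_Nil, rule uses_Lam, rule uses_closed[OF typed_eps]) simp
  have 2: "typed D (cons_trm b) (str n \<multimap> str n)" for b
    unfolding cons_trm_def
    by (rule uses_Nil) (rule uses_Lam uses_App[OF uses_closed[OF typed_letter]] uses_Var refl | simp)+
  show ?thesis unfolding write_symbol_def
    by (rule typed_select[OF 1]) (use 1 2 in auto)
qed

lemma typed_write_trm:
  assumes "n < m"
  shows "typed D write_trm (tree m \<multimap> str n)"
proof -
  have M: "typed D (Lam (Lam (Lam (Lam (App (App write_symbol (Var 3)) (Var 0))))))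
      (tree m \<multimap> tree m \<multimap> str n \<multimap> str n \<multimap> str n)"
    by (rule uses_Nil)
      (rule uses_Lam uses_App uses_Var uses_closed[OF typed_write_symbol] refl
        | simp add: eval_nat_numeral)+
  show ?thesis unfolding write_trm_def
    by (rule uses_Nil, rule uses_Lam, rule uses_Rec_tree[OF M typed_eps], rule uses_Var)
      (use assms in auto)
qed

lemma write_symbol_reds:
  "App (App write_symbol (tree_trm a)) (encode F (decode r)) \<leadsto>* encode F (decode (Node a r))"
proof -
  let ?Ms = "[Lam eps, cons_trm False, cons_trm True]"
  let ?S = "if left_depth a < length ?Ms then ?Ms ! left_depth a else Lam eps"
  have "App write_symbol (tree_trm a) \<leadsto>* ?S"
    unfolding write_symbol_def
    by (rule select_reds) (auto simp: cons_trm_def intro!: closedI)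
  from reds_App[OF this rtranclp.rtrancl_refl]
  have "App (App write_symbol (tree_trm a)) (encode F (decode r)) \<leadsto>* App ?S (encode F (decode r))" .
  also have "App ?S (encode F (decode r)) \<leadsto>* encode F (decode (Node a r))"
  proof -
    consider "left_depth a = 1" | "left_depth a = 2" | "left_depth a = 0" | "left_depth a \<ge> 3"
      by linarith
    then show ?thesis
      by cases (auto simp: cons_trm_def intro!: reds_beta_eq)
  qed
  finally show ?thesis .
qed

lemma write_trm_reds: "App write_trm (tree_trm t) \<leadsto>* encode F (decode t)"
proof -
  let ?M = "Lam (Lam (Lam (Lam (App (App write_symbol (Var 3)) (Var 0)))))"
  have "Rec (tree_trm t) [?M, eps] \<leadsto>* encode F (decode t)"
  proof (induction t)
    case Leaf
    show ?case unfolding tree_trm.simps decode.simps by (rule Rec_leaf)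
  next
    case (Node a r)
    have "Rec (tree_trm (Node a r)) [?M, eps]
        \<leadsto>* App (App (App (App ?M (tree_trm a)) (tree_trm r)) (encode F (decode a)))
              (encode F (decode r))"
      unfolding tree_trm.simps by (rule Rec_node[OF _ _ Node.IH]) simp_all
    also have "\<dots> \<leadsto>* App (App write_symbol (tree_trm a)) (encode F (decode r))"
      by (rule reds_beta_eq | rule reds_App_beta | simp add: eval_nat_numeral)+
    also have "\<dots> \<leadsto>* encode F (decode (Node a r))"
      by (rule write_symbol_reds)
    finally show ?case .
  qed
  moreover have "App write_trm (tree_trm t) \<leadsto>* Rec (tree_trm t) [?M, eps]"
    unfolding write_trm_def by (rule reds_beta_eq) (simp_all add: eval_nat_numeral)
  ultimately show ?thesis by (metis reds_trans)
qed

text \<open>The part \<open>(a, r)\<close> of a configuration tree is itself the stack of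
  \<open>a # r\<close>, so two projections expose the tape from the head rightwards.\<close>

definition output_trm :: "'c trm" where
  "output_trm = unpair (Lam (Lam (App
     (unpair (Lam (Lam (App write_trm (Var 0)))) eps) (Var (Suc 0))))) eps"

lemma closed_output_inner:
  "closed_trm (Lam (Lam (App write_trm (Var 0))))"
  "closed_trm (unpair (Lam (Lam (App write_trm (Var 0)))) eps)"
  "closed_trm (Lam (Lam (App (unpair (Lam (Lam (App write_trm (Var 0)))) eps) (Var (Suc 0)))))"
proof -
  show 1: "closed_trm (Lam (Lam (App write_trm (Var 0))))"
    by (rule closedI) simp
  show 2: "closed_trm (unpair (Lam (Lam (App write_trm (Var 0)))) eps)"
    by (rule closed_unpair[OF 1]) simp
  show "closed_trm (Lam (Lam (App (unpair (Lam (Lam (App write_trm (Var 0)))) eps) (Var (Suc 0)))))"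
    by (rule closedI) (use 2 in \<open>simp del: encode.simps\<close>)
qed

lemma closed_output_trm [simp]: "closed_trm output_trm"
  unfolding output_trm_def by (rule closed_unpair[OF closed_output_inner(3)]) simp

lemma typed_output_trm:
  assumes "n < m"
  shows "typed D output_trm (tree m \<multimap> str n)"
proof -
  have "typed D (Lam (Lam (App write_trm (Var 0)))) (tree m \<multimap> tree m \<multimap> str n)"
    by (rule uses_Nil) (rule uses_Lam uses_App uses_Var uses_closed[OF typed_write_trm[OF assms]] refl | simp)+
  note * = typed_unpair[OF this typed_eps]
  have "typed D (Lam (Lam (App (unpair (Lam (Lam (App write_trm (Var 0)))) eps) (Var (Suc 0)))))
      (tree m \<multimap> tree m \<multimap> str n)"
    by (rule uses_Nil) (rule uses_Lam uses_App uses_Var uses_closed[OF *] refl | simp)+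
  then show ?thesis unfolding output_trm_def by (rule typed_unpair[OF _ typed_eps])
qed

lemma output_trm_reds:
  "App output_trm (tree_trm (config_tree (q, l, a, r))) \<leadsto>* encode F (decode (stack (a # r)))"
proof -
  let ?W = "Lam (Lam (App write_trm (Var 0)))"
  let ?M = "Lam (Lam (App (unpair ?W eps) (Var (Suc 0))))"
  note c = closed_output_inner
  have "App output_trm (tree_trm (config_tree (q, l, a, r)))
      \<leadsto>* App (App ?M (tree_trm (Node (num q) (stack (a # r))))) (tree_trm (stack l))"
    unfolding output_trm_def config_tree.simps stack.simps
    by (rule unpair_Node[OF c(3)]) simp
  also have "\<dots> \<leadsto>* App (unpair ?W eps) (tree_trm (Node (num q) (stack (a # r))))"
    by (rule reds_beta_eq | rule reds_App_beta | simp add: c(2) del: encode.simps)+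
  also have "\<dots> \<leadsto>* App (App ?W (num_trm q)) (tree_trm (stack (a # r)))"
    by (rule unpair_Node[OF c(1)]) simp
  also have "\<dots> \<leadsto>* App write_trm (tree_trm (stack (a # r)))"
    by (rule reds_beta_eq | rule reds_App_beta | simp)+
  also have "\<dots> \<leadsto>* encode F (decode (stack (a # r)))"
    by (rule write_trm_reds)
  finally show ?thesis .
qed

subsection \<open>Representing computable functions\<close>

definition machine_trm :: "'c trm \<Rightarrow> nat \<Rightarrow> 'c trm" where
  "machine_trm P c = Lam (App (unpair (Lam (Lam
     (App output_trm (App (App P (Var (Suc 0)))
       (App (App (head_right 0 0) (App coerce (Var 0))) leaf))))) eps) (App (read_trm c) (Var 0)))"

text \<open>Levels fall along the computation: reading leads from \<open>Suc m\<close> to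
  \<open>m\<close>, copying the tape from \<open>m\<close> to \<open>n\<close>, writing the output
  from \<open>n\<close> to 0.\<close>

lemma typed_machine_trm:
  assumes "typed D P (tree m \<multimap> tree n \<multimap> tree n)" "n < m" "0 < n"
  shows "typed D (machine_trm P c) (str (Suc m) \<multimap> str 0)"
proof -
  have "typed D (Lam (Lam
     (App output_trm (App (App P (Var (Suc 0)))
       (App (App (head_right 0 0) (App coerce (Var 0))) leaf))))) (tree m \<multimap> tree m \<multimap> str 0)"
    by (rule uses_Nil) (rule uses_Lam uses_App uses_Var uses_closed[OF assms(1)]
      uses_closed[OF typed_output_trm[OF assms(3)]] uses_closed[OF typed_head_right]
      uses_closed[OF typed_coerce[OF assms(2)]] uses_closed[OF typed_leaf] refl | simp)+
  note * = typed_unpair[OF this typed_eps]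
  have r: "typed D (read_trm c) (str (Suc m) \<multimap> tree m)"
    by (rule typed_read_trm) simp
  show ?thesis unfolding machine_trm_def
    by (rule uses_Nil)
      (rule uses_Lam uses_App uses_Var uses_closed[OF *] uses_closed[OF r] refl | simp)+
qed

text \<open>The clock may run longer than the machine, because a halted configuration is a fixed
  point. \<open>P\<close> has to work for every \<open>e\<close>, since the run depends on the
  input; the shift \<open>c\<close> of the numeral lets \<open>g\<close> dominate the time
  bound.\<close>

lemma represents_machine_trm:
  assumes T: "wf_tm T" "computes_in_time T f b"
    and P: "closed_trm P"
      "\<And>e n. advances e 1 (step_trm T) \<Longrightarrow> advances e (g n) (App P (num_trm n))"
    and g: "\<And>n. b n \<le> g (n + c)"
  shows "represents F (machine_trm P c) f"
  unfolding represents_def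
proof
  fix s
  define k where "k i = (list_step T ^^ i) (initial s)" for i
  define cfg where "cfg i = (tm_step T ^^ i) (tm_init s)" for i
  let ?e = "\<lambda>i. config_tree (k i)"
  have sim: "simulates T (cfg i) (k i)" for i
    by (induction i) (simp_all add: k_def cfg_def simulates_initial[OF T(1)] simulates_step[OF T(1)]
        del: initial.simps)
  have step: "App (step_trm T) (tree_trm (?e i)) \<leadsto>* tree_trm (?e (i + 1))" for i
  proof -
    obtain q tp h where c: "cfg i = (q, tp, h)" by (cases "cfg i")
    obtain q' l a r where k: "k i = (q', l, a, r)" by (cases "k i")
    have "q' < nstates T" "a < nsymbols T"
      using sim[of i] unfolding c k by auto
    moreover have "k (i + 1) = list_step T (k i)" by (simp add: k_def)
    ultimately show ?thesis using step_trm_reds k by metis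
  qed
  have "advances ?e 1 (step_trm T)"
    unfolding advances_def
  proof (intro exI conjI allI)
    show "step_trm T \<leadsto>* step_trm T" "closed_trm (step_trm T)" by simp_all
    show "val (step_trm T)" by (simp add: step_trm_def unpair_def)
    show "App (step_trm T) (tree_trm (?e i)) \<leadsto>* tree_trm (?e (i + 1))" for i
      by (rule step)
  qed
  note P_adv = advances_App[OF P(2)[OF this], of _ 0, unfolded add_0]
  define w where "w = stack (map letter s)"
  let ?n = "length s + c"
  let ?M = "Lam (Lam (App output_trm (App (App P (Var (Suc 0)))
    (App (App (head_right 0 0) (App coerce (Var 0))) leaf))))"
  have M: "closed_trm ?M" by (rule closedI) (simp add: P)
  have U: "closed_trm (unpair ?M eps)" by (rule closed_unpair[OF M]) simp
  have start: "App (App (head_right 0 0) (App coerce (tree_trm w))) leaf \<leadsto>* tree_trm (?e 0)"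
  proof -
    have "App (App (head_right 0 0) (App coerce (tree_trm w))) (tree_trm Leaf)
        \<leadsto>* App (App (head_right 0 0) (tree_trm w)) (tree_trm Leaf)"
      by (intro reds_App[OF _ rtranclp.rtrancl_refl] reds_App[OF rtranclp.rtrancl_refl] coerce_reds)
    also have "\<dots> \<leadsto>* tree_trm (?e 0)"
      using head_right_reds[of 0 0 "map letter s" Leaf]
      by (cases s) (simp_all add: k_def w_def)
    finally show ?thesis by simp
  qed
  have "App (machine_trm P c) (encode F s) \<leadsto>* App (unpair ?M eps) (App (read_trm c) (encode F s))"
    unfolding machine_trm_def by (rule reds_beta_eq) (simp_all add: U del: encode.simps)
  also have "\<dots> \<leadsto>* App (unpair ?M eps) (tree_trm (Node (num ?n) w))"
    unfolding w_def by (rule reds_App[OF rtranclp.rtrancl_refl read_trm_reds])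
  also have "\<dots> \<leadsto>* App (App ?M (num_trm ?n)) (tree_trm w)"
    by (rule unpair_Node[OF M]) simp
  also have "\<dots> \<leadsto>* App output_trm (App (App P (num_trm ?n))
      (App (App (head_right 0 0) (App coerce (tree_trm w))) leaf))"
    by (rule reds_beta_eq | rule reds_App_beta | simp add: P)+
  also have "\<dots> \<leadsto>* App output_trm (App (App P (num_trm ?n)) (tree_trm (?e 0)))"
    by (rule reds_App[OF rtranclp.rtrancl_refl reds_App[OF rtranclp.rtrancl_refl start]])
  also have "\<dots> \<leadsto>* App output_trm (tree_trm (?e (g ?n)))"
    by (rule reds_App[OF rtranclp.rtrancl_refl P_adv])
  also have "\<dots> \<leadsto>* encode F (f s)"
  proof -
    obtain t where t: "t \<le> b (length s)" "tm_halted T (cfg t)" "tm_output (cfg t) (f s)"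
      using T(2) unfolding computes_in_time_def cfg_def by blast
    have "cfg (g ?n) = cfg t"
      using halted_funpow[of T t "tm_init s" "g ?n"] t(1,2) g[of "length s"] unfolding cfg_def by simp
    obtain q tp h where c: "cfg t = (q, tp, h)" by (cases "cfg t")
    obtain q' l a r where k: "k (g ?n) = (q', l, a, r)" by (cases "k (g ?n)")
    have tp: "tp h = a" "\<And>i. tp (h + 1 + int i) = symbol_at r i"
      using sim[of "g ?n"] unfolding \<open>cfg (g ?n) = cfg t\<close> c k by auto
    have "symbol_at (a # r) i = tp (h + int i)" for i
      using tp(1) tp(2)[of "i - 1"] by (cases i) (simp_all add: algebra_simps)
    then have "decode (stack (a # r)) = f s"
      using t(3) unfolding c by (intro decode_stack) simp_all
    then show ?thesis using output_trm_reds[of q' l a r] unfolding k by (simp only:)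
  qed
  finally show "App (machine_trm P c) (encode F s) \<leadsto>* encode F (f s)" .
qed

end

section \<open>Polynomials bounded by binomial coefficients\<close>

text \<open>Induction along Horner's scheme: multiplication by \<open>n\<close> and by constants is
  absorbed into larger indices.\<close>

lemma poly_le_binomial:
  fixes p :: "nat poly"
  shows "\<exists>c k. \<forall>n. poly p n \<le> (n + c) choose k"
proof (induction p)
  case 0
  show ?case by simp
next
  case (pCons a p)
  then obtain c k where le: "\<And>n. poly p n \<le> (n + c) choose k" by blast
  \<comment> \<open>Each copy of \<open>m choose l\<close> is gained by one application of Pascal's
    rule as the upper index grows by one.\<close>
  have mult: "j * (m choose l) \<le> (m + j) choose Suc l" for j m l
  proof (induction j)
    case (Suc j)
    have "m choose l \<le> (m + j) choose l" by (rule binomial_right_mono) simp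
    with Suc show ?case by simp
  qed simp
  \<comment> \<open>The lower index grows by one each for the factor \<open>n\<close>, for the
    factor \<open>Suc k\<close> that this leaves behind, and for \<open>Suc a\<close>. The upper one
    grows by \<open>1\<close>, \<open>Suc k\<close> and \<open>Suc a\<close>.\<close>
  have "poly (pCons a p) n \<le> (n + (c + k + a + 3)) choose (k + 3)" for n
  proof -
    let ?m = "n + c"
    have "n * poly p n \<le> Suc ?m * (?m choose k)"
      using le[of n] by (intro mult_mono) auto
    also have "\<dots> = Suc k * (Suc ?m choose Suc k)"
      by (simp only: Suc_times_binomial_eq mult.commute[of "Suc k"])
    also have "\<dots> \<le> (Suc ?m + Suc k) choose Suc (Suc k)"
      by (rule mult)
    finally have *: "n * poly p n \<le> (?m + k + 2) choose (k + 2)"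
      by (simp add: eval_nat_numeral)
    have "1 \<le> (?m + k + 2) choose (k + 2)"
      using zero_less_binomial[of "k + 2" "?m + k + 2"] by linarith
    then have "a \<le> a * ((?m + k + 2) choose (k + 2))"
      by (metis mult.right_neutral mult_le_mono2)
    then have "poly (pCons a p) n \<le> a * ((?m + k + 2) choose (k + 2)) + ((?m + k + 2) choose (k + 2))"
      using * by (simp only: poly_pCons add_mono)
    also have "\<dots> = Suc a * ((?m + k + 2) choose (k + 2))"
      by (simp only: mult_Suc add.commute)
    also have "\<dots> \<le> (?m + k + 2 + Suc a) choose Suc (k + 2)"
      by (rule mult)
    also have "?m + k + 2 + Suc a = n + (c + k + a + 3)" by simp
    also have "Suc (k + 2) = k + 3" by simp
    finally show ?thesis .
  qed
  then show ?case by (intro exI[of _ "c + k + a + 3"] exI[of _ "k + 3"]) simp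
qed

lemma tower_mono: "m \<le> n \<Longrightarrow> tower k m \<le> tower k n"
  by (induction k) auto

theorem theorem6:
  fixes F :: "('a::finite, 'c) algebra_family"
  assumes "free_algebra_family F"
  shows "(\<forall>f. polytime_computable f \<longrightarrow>
            (\<exists>M n. RH F {} Map.empty M (Base (algB F) n \<multimap> Base (algB F) 0) \<and> represents F M f)) \<and>
         (\<forall>f. elementary_time_computable f \<longrightarrow>
            (\<exists>M n. RH F base_types Map.empty M (Base (algB F) n \<multimap> Base (algB F) 0) \<and> represents F M f))"
proof (intro conjI allI impI)
  interpret free_algebras F by (rule free_algebras.intro[OF assms])
  fix f
  {
    assume "polytime_computable f"
    then obtain T and p :: "nat poly" where T: "wf_tm T" "computes_in_time T f (poly p)"
      unfolding polytime_computable_def by blast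
    obtain c k where "\<And>n. poly p n \<le> (n + c) choose k"
      using poly_le_binomial by blast
    then have "represents F (machine_trm (binomial_clock (step_trm T) k) c) f"
      by (intro represents_machine_trm[OF T, where g = "\<lambda>n. n choose k"] advances_binomial_clock) simp_all
    \<comment> \<open>Configurations get level 1, the least that allows writing the output at level
      0; the clock input then has level 2 and the string level 3.\<close>
    moreover have "RH F {} Map.empty (machine_trm (binomial_clock (step_trm T) k) c)
        (Base (algB F) 3 \<multimap> Base (algB F) 0)"
      using typed_machine_trm[OF typed_binomial_clock[OF typed_step_trm, of 1 2]] by simp
    ultimately show "\<exists>M n. RH F {} Map.empty M (Base (algB F) n \<multimap> Base (algB F) 0) \<and> represents F M f"
      by blast
  next
    assume "elementary_time_computable f"
    then obtain T k where T: "wf_tm T" "computes_in_time T f (tower k)"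
      unfolding elementary_time_computable_def by blast
    \<comment> \<open>\<open>num n\<close> has \<open>Suc n\<close> leaves, so the clock already
      exceeds the time bound and \<open>c = 0\<close> suffices.\<close>
    have "advances e (tower k (Suc n)) (App (tower_clock (step_trm T) k) (num_trm n))"
      if "advances e 1 (step_trm T)" for e n
      using advances_tower_clock[OF closed_step_trm that, of k "num n"] by simp
    then have "represents F (machine_trm (tower_clock (step_trm T) k) 0) f"
      by (intro represents_machine_trm[OF T, where g = "\<lambda>n. tower k (Suc n)"])
        (simp_all add: tower_mono)
    \<comment> \<open>The \<open>k\<close> exponentials raise the level of the clock input to
      \<open>k + 2\<close>, and reading adds one.\<close>
    moreover have "RH F base_types Map.empty (machine_trm (tower_clock (step_trm T) k) 0)
        (Base (algB F) (Suc (k + 2)) \<multimap> Base (algB F) 0)"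
      by (rule typed_machine_trm[OF typed_tower_clock[OF typed_step_trm, of 1 2]]) simp_all
    ultimately show "\<exists>M n. RH F base_types Map.empty M (Base (algB F) n \<multimap> Base (algB F) 0) \<and> represents F M f"
      by blast
  }
qed

end
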